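(* The Poincaré distance $\delta_\Delta$ of the unit disc $\Delta_{\mathbb{H}}$ is the integrated distance of the Poincaré differential metric of $\Delta_{\mathbb{H}}$.
   Context: $\mathbb{H}\cong\mathbb{R}^4$ is the skew field of real quaternions and $\Delta_{\mathbb{H}}=\{q\in\mathbb{H}:|q|<1\}$. The cross-ratio is $\mathcal{CR}(q_1,q_2,q_3,q_4)=(q_1-q_3)(q_1-q_4)^{-1}(q_2-q_4)(q_2-q_3)^{-1}$. The non-Euclidean line through $q_1\ne q_2\in\Delta_{\mathbb{H}}$ is the diameter of $\Delta_{\mathbb{H}}$ containing them if $q_1,q_2$ are $\mathbb{R}$-linearly dependent, and otherwise the unique circle through $q_1,q_2$ that intersects $\partial\Delta_{\mathbb{H}}$ orthogonally; its two ends are its intersection points with $\partial\Delta_{\mathbb{H}}$. The Poincaré distance is $\delta_\Delta(q_1,q_2)=\frac12\log\big(\mathcal{CR}(q_1,q_2,q_3,q_4)\big)$, where $q_3,q_4$ are the ends of the non-Euclidean line through $q_1,q_2$, named so that $q_1,q_2,q_3,q_4$ are arranged cyclically on it (for example, $\delta_\Delta(0,t)=\frac12\log\mathcal{CR}(0,t,1,-1)$ for $0<t<1$); and $\delta_\Delta(q,q)=0$. The Poincaré differential metric assigns to a vector $\tau\in\mathbb{H}$ at $q\in\Delta_{\mathbb{H}}$ the length $\langle\tau\rangle_q=\dfrac{|\tau|}{1-|q|^2}$. Its integrated distance between two points is the infimum, over all piecewise differentiable arcs in $\Delta_{\mathbb{H}}$ joining them, of the length of the arc computed with this differential metric. *)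

theory Defs
  imports "HOL-Analysis.Analysis"
begin

section \<open>The skew field of real quaternions\<close>

datatype quat = Quat (qRe: real) (qIm1: real) (qIm2: real) (qIm3: real)

lemma quat_eq_iff:
  "x = y \<longleftrightarrow> qRe x = qRe y \<and> qIm1 x = qIm1 y \<and> qIm2 x = qIm2 y \<and> qIm3 x = qIm3 y"
  by (cases x; cases y) simp

instantiation quat :: ab_group_add
begin

definition "0 = Quat 0 0 0 0"
definition "x + y = Quat (qRe x + qRe y) (qIm1 x + qIm1 y) (qIm2 x + qIm2 y) (qIm3 x + qIm3 y)"
definition "- x = Quat (- qRe x) (- qIm1 x) (- qIm2 x) (- qIm3 x)"
definition "x - y = Quat (qRe x - qRe y) (qIm1 x - qIm1 y) (qIm2 x - qIm2 y) (qIm3 x - qIm3 y)"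

instance
  by standard (simp_all add: zero_quat_def plus_quat_def uminus_quat_def minus_quat_def)

end

lemma quat_additive_simps [simp]:
  "qRe 0 = 0" "qIm1 0 = 0" "qIm2 0 = 0" "qIm3 0 = 0"
  "qRe (x + y) = qRe x + qRe y" "qIm1 (x + y) = qIm1 x + qIm1 y"
  "qIm2 (x + y) = qIm2 x + qIm2 y" "qIm3 (x + y) = qIm3 x + qIm3 y"
  "qRe (- x) = - qRe x" "qIm1 (- x) = - qIm1 x" "qIm2 (- x) = - qIm2 x" "qIm3 (- x) = - qIm3 x"
  "qRe (x - y) = qRe x - qRe y" "qIm1 (x - y) = qIm1 x - qIm1 y"
  "qIm2 (x - y) = qIm2 x - qIm2 y" "qIm3 (x - y) = qIm3 x - qIm3 y"
  by (simp_all add: zero_quat_def plus_quat_def uminus_quat_def minus_quat_def)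

instantiation quat :: real_vector
begin

definition "r *\<^sub>R x = Quat (r * qRe x) (r * qIm1 x) (r * qIm2 x) (r * qIm3 x)"

instance
  by standard (simp_all add: scaleR_quat_def quat_eq_iff algebra_simps)

end

lemma quat_scaleR_simps [simp]:
  "qRe (r *\<^sub>R x) = r * qRe x" "qIm1 (r *\<^sub>R x) = r * qIm1 x"
  "qIm2 (r *\<^sub>R x) = r * qIm2 x" "qIm3 (r *\<^sub>R x) = r * qIm3 x"
  by (simp_all add: scaleR_quat_def)

instantiation quat :: real_algebra_1
begin

definition "1 = Quat 1 0 0 0"

definition "x * y =
  Quat (qRe x * qRe y - qIm1 x * qIm1 y - qIm2 x * qIm2 y - qIm3 x * qIm3 y)
       (qRe x * qIm1 y + qIm1 x * qRe y + qIm2 x * qIm3 y - qIm3 x * qIm2 y)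
       (qRe x * qIm2 y - qIm1 x * qIm3 y + qIm2 x * qRe y + qIm3 x * qIm1 y)
       (qRe x * qIm3 y + qIm1 x * qIm2 y - qIm2 x * qIm1 y + qIm3 x * qRe y)"

instance
  by standard (simp_all add: one_quat_def times_quat_def quat_eq_iff algebra_simps)

end

lemma quat_mult_simps [simp]:
  "qRe 1 = 1" "qIm1 1 = 0" "qIm2 1 = 0" "qIm3 1 = 0"
  "qRe (x * y) = qRe x * qRe y - qIm1 x * qIm1 y - qIm2 x * qIm2 y - qIm3 x * qIm3 y"
  "qIm1 (x * y) = qRe x * qIm1 y + qIm1 x * qRe y + qIm2 x * qIm3 y - qIm3 x * qIm2 y"
  "qIm2 (x * y) = qRe x * qIm2 y - qIm1 x * qIm3 y + qIm2 x * qRe y + qIm3 x * qIm1 y"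
  "qIm3 (x * y) = qRe x * qIm3 y + qIm1 x * qIm2 y - qIm2 x * qIm1 y + qIm3 x * qRe y"
  by (simp_all add: one_quat_def times_quat_def)

lemma quat_sum_squares_eq_0_iff:
  "(qRe x)\<^sup>2 + (qIm1 x)\<^sup>2 + (qIm2 x)\<^sup>2 + (qIm3 x)\<^sup>2 = 0 \<longleftrightarrow> x = 0"
  by (simp add: quat_eq_iff add_nonneg_eq_0_iff)

instantiation quat :: real_div_algebra
begin

definition inverse_quat_def:
  "inverse x = (1 / ((qRe x)\<^sup>2 + (qIm1 x)\<^sup>2 + (qIm2 x)\<^sup>2 + (qIm3 x)\<^sup>2)) *\<^sub>R
     Quat (qRe x) (- qIm1 x) (- qIm2 x) (- qIm3 x)"

definition divide_quat_def: "x div y = x * inverse y" for x y :: quat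

instance
proof
  fix x y :: quat
  define n where "n = (qRe x)\<^sup>2 + (qIm1 x)\<^sup>2 + (qIm2 x)\<^sup>2 + (qIm3 x)\<^sup>2"
  define c where "c = Quat (qRe x) (- qIm1 x) (- qIm2 x) (- qIm3 x)"
  have inv: "inverse x = (1 / n) *\<^sub>R c"
    by (simp add: inverse_quat_def n_def c_def)
  have cx: "c * x = n *\<^sub>R 1" and xc: "x * c = n *\<^sub>R 1"
    by (simp_all add: c_def n_def quat_eq_iff power2_eq_square)
  show "inverse x * x = 1" if "x \<noteq> 0"
    using that cx by (simp add: inv quat_sum_squares_eq_0_iff n_def)
  show "x * inverse x = 1" if "x \<noteq> 0"
    using that xc by (simp add: inv quat_sum_squares_eq_0_iff n_def)
  show "x div y = x * inverse y"
    by (rule divide_quat_def)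
  show "inverse (0 :: quat) = 0"
    by (simp add: inverse_quat_def quat_eq_iff)
qed

end

instantiation quat :: real_normed_div_algebra
begin

definition norm_quat_def: "norm x = sqrt ((qRe x)\<^sup>2 + (qIm1 x)\<^sup>2 + (qIm2 x)\<^sup>2 + (qIm3 x)\<^sup>2)"

definition sgn_quat_def: "sgn x = x /\<^sub>R norm x" for x :: quat

definition dist_quat_def: "dist x y = norm (x - y)" for x y :: quat

definition uniformity_quat_def:
  "(uniformity :: (quat \<times> quat) filter) = (INF e\<in>{0 <..}. principal {(x, y). dist x y < e})"

definition open_quat_def:
  "open (U :: quat set) \<longleftrightarrow> (\<forall>x\<in>U. eventually (\<lambda>(x', y). x' = x \<longrightarrow> y \<in> U) uniformity)"

instance
proof
  fix r :: real and x y :: quat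
  show "(norm x = 0) = (x = 0)"
    by (simp add: norm_quat_def quat_sum_squares_eq_0_iff)
  have np: "norm z = norm ((qRe z, qIm1 z), (qIm2 z, qIm3 z))" for z :: quat
    by (simp add: norm_quat_def norm_prod_def)
  show "norm (x + y) \<le> norm x + norm y"
    using norm_triangle_ineq[of "((qRe x, qIm1 x), (qIm2 x, qIm3 x))" "((qRe y, qIm1 y), (qIm2 y, qIm3 y))"]
    by (simp add: np)
  show "norm (r *\<^sub>R x) = \<bar>r\<bar> * norm x"
    by (simp add: norm_quat_def power_mult_distrib distrib_left [symmetric] real_sqrt_mult)
  show "norm (x * y) = norm x * norm y"
    unfolding norm_quat_def real_sqrt_mult [symmetric]
    by (rule arg_cong[where f = sqrt]) (simp add: power2_eq_square algebra_simps)
qed (rule sgn_quat_def dist_quat_def open_quat_def uniformity_quat_def)+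

end

instantiation quat :: real_inner
begin

definition inner_quat_def:
  "inner x y = qRe x * qRe y + qIm1 x * qIm1 y + qIm2 x * qIm2 y + qIm3 x * qIm3 y"

instance
proof
  fix x y z :: quat and r :: real
  show "inner x y = inner y x"
    by (simp add: inner_quat_def mult.commute)
  show "inner (x + y) z = inner x z + inner y z"
    by (simp add: inner_quat_def algebra_simps)
  show "inner (r *\<^sub>R x) y = r * inner x y"
    by (simp add: inner_quat_def algebra_simps)
  show "0 \<le> inner x x"
    by (simp add: inner_quat_def)
  show "inner x x = 0 \<longleftrightarrow> x = 0"
    using quat_sum_squares_eq_0_iff[of x] by (simp add: inner_quat_def power2_eq_square)
  show "norm x = sqrt (inner x x)"
    by (simp add: inner_quat_def norm_quat_def power2_eq_square)
qed

end

instantiation quat :: euclidean_space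
begin

definition Basis_quat_def: "Basis = {Quat 1 0 0 0, Quat 0 1 0 0, Quat 0 0 1 0, Quat 0 0 0 1}"

instance
proof
  show "(Basis :: quat set) \<noteq> {}" and "finite (Basis :: quat set)"
    by (simp_all add: Basis_quat_def)
  fix x y :: quat
  show "inner x y = (if x = y then 1 else 0)" if "x \<in> Basis" "y \<in> Basis"
    using that unfolding Basis_quat_def by (elim insertE emptyE) (simp_all add: inner_quat_def)
  show "(\<forall>u\<in>Basis. inner x u = 0) \<longleftrightarrow> x = 0"
    by (simp add: Basis_quat_def inner_quat_def quat_eq_iff[of x 0])
qed

end

section \<open>Non-Euclidean lines and the Poincare distance\<close>

abbreviation unit_disc :: "quat set" where
  "unit_disc \<equiv> ball 0 1"

definition cross_ratio :: "quat \<Rightarrow> quat \<Rightarrow> quat \<Rightarrow> quat \<Rightarrow> quat" where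
  "cross_ratio q1 q2 q3 q4 =
     (q1 - q3) * inverse (q1 - q4) * (q2 - q4) * inverse (q2 - q3)"

definition is_diameter :: "quat set \<Rightarrow> bool" where
  "is_diameter L \<longleftrightarrow> (\<exists>u. norm u = 1 \<and> L = closed_segment (- u) u)"

definition circle_frame :: "real \<Rightarrow> quat \<Rightarrow> quat \<Rightarrow> bool" where
  "circle_frame r u v \<longleftrightarrow> 0 < r \<and> norm u = 1 \<and> norm v = 1 \<and> orthogonal u v"

text \<open>For \<open>circle_frame r u v\<close>, this parametrizes the circle with centre \<open>c\<close> and radius \<open>r\<close>
  in the affine 2-plane through \<open>c\<close> spanned by \<open>u\<close> and \<open>v\<close>.\<close>

definition circle_param :: "quat \<Rightarrow> real \<Rightarrow> quat \<Rightarrow> quat \<Rightarrow> real \<Rightarrow> quat" where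
  "circle_param c r u v t = c + r *\<^sub>R (cos t *\<^sub>R u + sin t *\<^sub>R v)"

text \<open>A circle that meets the unit sphere, and does so orthogonally: at every common point \<open>p\<close>
  its tangent vector is orthogonal to the tangent hyperplane \<open>{w. orthogonal w p}\<close> of the sphere.
  The condition that the intersection is nonempty excludes circles inside the open disc.\<close>

definition is_orthogonal_circle :: "quat set \<Rightarrow> bool" where
  "is_orthogonal_circle L \<longleftrightarrow>
     (\<exists>c r u v. circle_frame r u v \<and> L = range (circle_param c r u v) \<and>
        L \<inter> sphere 0 1 \<noteq> {} \<and>
        (\<forall>t. circle_param c r u v t \<in> sphere 0 1 \<longrightarrow>
           (\<forall>w. orthogonal w (circle_param c r u v t) \<longrightarrow>
                orthogonal w (vector_derivative (circle_param c r u v) (at t)))))"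

definition noneuclidean_line :: "quat \<Rightarrow> quat \<Rightarrow> quat set" where
  "noneuclidean_line q1 q2 =
     (if dependent {q1, q2}
      then THE L. is_diameter L \<and> q1 \<in> L \<and> q2 \<in> L
      else THE L. is_orthogonal_circle L \<and> q1 \<in> L \<and> q2 \<in> L)"

definition line_ends :: "quat \<Rightarrow> quat \<Rightarrow> quat set" where
  "line_ends q1 q2 = noneuclidean_line q1 q2 \<inter> sphere 0 1"

text \<open>Both orientations of a circle or diameter are admitted, since \<open>v\<close> (resp. \<open>u\<close>) may be
  replaced by its negative. A diameter is cyclically ordered as part of a line closed up at infinity, so
  that \<open>0, t, 1, -1\<close> are arranged cyclically on the real diameter for \<open>0 < t < 1\<close>.\<close>

definition cyclic_on_circle :: "quat set \<Rightarrow> quat \<Rightarrow> quat \<Rightarrow> quat \<Rightarrow> quat \<Rightarrow> bool" where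
  "cyclic_on_circle L q1 q2 q3 q4 \<longleftrightarrow>
     (\<exists>c r u v t1 t2 t3 t4. circle_frame r u v \<and> L = range (circle_param c r u v) \<and>
        t1 < t2 \<and> t2 < t3 \<and> t3 < t4 \<and> t4 < t1 + 2 * pi \<and>
        q1 = circle_param c r u v t1 \<and> q2 = circle_param c r u v t2 \<and>
        q3 = circle_param c r u v t3 \<and> q4 = circle_param c r u v t4)"

definition cyclic_on_diameter :: "quat set \<Rightarrow> quat \<Rightarrow> quat \<Rightarrow> quat \<Rightarrow> quat \<Rightarrow> bool" where
  "cyclic_on_diameter L q1 q2 q3 q4 \<longleftrightarrow>
     (\<exists>u t1 t2 t3 t4. norm u = 1 \<and> L = closed_segment (- u) u \<and> {q1, q2, q3, q4} \<subseteq> L \<and>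
        q1 = t1 *\<^sub>R u \<and> q2 = t2 *\<^sub>R u \<and> q3 = t3 *\<^sub>R u \<and> q4 = t4 *\<^sub>R u \<and>
        (t1 < t2 \<and> t2 < t3 \<and> t3 < t4 \<or> t2 < t3 \<and> t3 < t4 \<and> t4 < t1 \<or>
         t3 < t4 \<and> t4 < t1 \<and> t1 < t2 \<or> t4 < t1 \<and> t1 < t2 \<and> t2 < t3))"

definition arranged_cyclically :: "quat set \<Rightarrow> quat \<Rightarrow> quat \<Rightarrow> quat \<Rightarrow> quat \<Rightarrow> bool" where
  "arranged_cyclically L q1 q2 q3 q4 \<longleftrightarrow>
     cyclic_on_circle L q1 q2 q3 q4 \<or> cyclic_on_diameter L q1 q2 q3 q4"

text \<open>The cross-ratio of four points arranged cyclically on a circle or line is a positive real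
  quaternion \<open>of_real x\<close>; its logarithm is the real number \<open>ln x\<close>.\<close>

definition poincare_dist :: "quat \<Rightarrow> quat \<Rightarrow> real" where
  "poincare_dist q1 q2 =
     (if q1 = q2 then 0
      else THE d. \<exists>q3 q4 x. line_ends q1 q2 = {q3, q4} \<and>
             arranged_cyclically (noneuclidean_line q1 q2) q1 q2 q3 q4 \<and>
             0 < x \<and> cross_ratio q1 q2 q3 q4 = of_real x \<and> d = 1 / 2 * ln x)"

section \<open>The Poincare differential metric and its integrated distance\<close>

definition poincare_metric :: "quat \<Rightarrow> quat \<Rightarrow> real" where
  "poincare_metric q \<tau> = norm \<tau> / (1 - (norm q)\<^sup>2)"

definition arcs_joining :: "quat \<Rightarrow> quat \<Rightarrow> (real \<Rightarrow> quat) set" where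
  "arcs_joining q1 q2 =
     {\<gamma>. \<gamma> piecewise_differentiable_on {0..1} \<and> path_image \<gamma> \<subseteq> unit_disc \<and>
         pathstart \<gamma> = q1 \<and> pathfinish \<gamma> = q2}"

text \<open>The length takes values in \<^typ>\<open>ennreal\<close>: an arc in the sense of the library predicate
  may have unbounded derivative near a break point, hence infinite length.\<close>

definition poincare_length :: "(real \<Rightarrow> quat) \<Rightarrow> ennreal" where
  "poincare_length \<gamma> =
     (\<integral>\<^sup>+t\<in>{0..1}. ennreal (poincare_metric (\<gamma> t) (vector_derivative \<gamma> (at t within {0..1}))) \<partial>lborel)"

definition integrated_dist :: "quat \<Rightarrow> quat \<Rightarrow> ennreal" where
  "integrated_dist q1 q2 = (INF \<gamma>\<in>arcs_joining q1 q2. poincare_length \<gamma>)"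

end

theory Submission
  imports Defs
begin

text \<open>
  Both sides of the claimed equation are equal to \<open>artanh (norm z)\<close>, where \<open>z\<close> is the image of \<open>q2\<close>
  under the Moebius transformation \<open>q \<mapsto> (q - q1) * inverse (1 - qcnj q1 * q)\<close>.

  For the integrated distance, this transformation maps the disc to itself, preserves the Poincare
  differential metric (\<open>poincare_metric_disc_moebius\<close>) and moves \<open>q1\<close> to the origin. From
  the origin, the radius to \<open>z\<close> has length \<open>artanh (norm z)\<close> (\<open>geodesic_arc\<close>). No arc is
  shorter, because the speed of its component along \<open>z\<close>, measured in the one-dimensional disc, is at
  most its own speed (\<open>artanh_le_poincare_length\<close>).

  For the distance defined by the cross-ratio, the two ends of a non-Euclidean line can be named in
  just one way that gives a cross-ratio larger than 1, and points arranged cyclically always have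
  such a cross-ratio, by Ptolemy's theorem (\<open>arranged_cyclically_cross_ratio_gt_one\<close>). It remains to
  compute. On a circle, the differences of points are real multiples of tangent directions, whose
  quotients behave like complex numbers of modulus 1 and cancel in the cross-ratio
  (\<open>circle_cross_ratio\<close>). This leaves a real number, a quotient \<open>P / Q\<close> of products of sines. The length of the chord from \<open>q1\<close> to \<open>q2\<close> and the weights
  \<open>1 - (norm q1)\<^sup>2\<close> and \<open>1 - (norm q2)\<^sup>2\<close> are products of sines too, and comparing them gives
  \<open>norm z = (P - Q) / (P + Q)\<close> (\<open>half_ln_eq_artanh_disc_moebius\<close>, \<open>poincare_dist_independent\<close>).

  The orthogonal circle through two independent points is unique, since orthogonality forces it to
  lie in a plane through the origin and puts on its centre \<open>c\<close> the linear condition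
  \<open>(norm q)\<^sup>2 + 1 = 2 * inner c q\<close> for each of its points \<open>q\<close> (\<open>orthogonal_circle_eq\<close>). Solving
  the two conditions proves that the circle exists (\<open>exists_geodesic_circle\<close>). On a diameter the same
  computation works with coordinates in place of sines (\<open>poincare_dist_dependent\<close>).
\<close>

section \<open>Moebius transformations of the quaternionic disc\<close>

definition qcnj :: "quat \<Rightarrow> quat" where
  "qcnj q = Quat (qRe q) (- qIm1 q) (- qIm2 q) (- qIm3 q)"

lemma qcnj_simps [simp]:
  "qRe (qcnj q) = qRe q" "qIm1 (qcnj q) = - qIm1 q"
  "qIm2 (qcnj q) = - qIm2 q" "qIm3 (qcnj q) = - qIm3 q"
  by (simp_all add: qcnj_def)

lemma norm_quat_square: "(norm q)\<^sup>2 = (qRe q)\<^sup>2 + (qIm1 q)\<^sup>2 + (qIm2 q)\<^sup>2 + (qIm3 q)\<^sup>2"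
  by (simp add: norm_quat_def)

lemma norm_qcnj [simp]: "norm (qcnj q) = norm q"
  by (simp add: norm_quat_def)

lemma qcnj_minus [simp]: "qcnj (- q) = - qcnj q"
  by (simp add: quat_eq_iff)

lemma qcnj_mult_self: "qcnj q * q = ((norm q)\<^sup>2) *\<^sub>R 1" "q * qcnj q = ((norm q)\<^sup>2) *\<^sub>R 1"
  unfolding norm_quat_square by (simp_all add: quat_eq_iff power2_eq_square)

lemma qRe_qcnj_mult: "qRe (qcnj a * q) = inner a q" "qRe (q * qcnj a) = inner a q"
  by (simp_all add: inner_quat_def algebra_simps)

lemma norm_one_minus_square: "(norm (1 - x))\<^sup>2 = 1 - 2 * qRe x + (norm x)\<^sup>2" for x :: quat
  unfolding norm_quat_square by (simp add: power2_eq_square algebra_simps)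

text \<open>The noncommutative analogue of the Blaschke factor \<open>(q - a) / (1 - cnj a * q)\<close>. It moves
  \<open>a\<close> to the origin.\<close>

definition disc_moebius :: "quat \<Rightarrow> quat \<Rightarrow> quat" where
  "disc_moebius a q = (q - a) * inverse (1 - qcnj a * q)"

lemma one_minus_mult_nonzero:
  fixes x y :: quat
  assumes "norm x < 1" "norm y < 1"
  shows "1 - x * y \<noteq> 0"
proof
  assume "1 - x * y = 0"
  hence "norm (x * y) = 1" by (metis norm_one eq_iff_diff_eq_0)
  moreover have "norm x * norm y < 1 * 1"
    by (intro mult_strict_mono') (use assms in auto)
  ultimately show False by (simp add: norm_mult)
qed

lemma norm_denominator_commute: "norm (1 - q * qcnj a) = norm (1 - qcnj a * q)"
proof -
  have "(norm (1 - q * qcnj a))\<^sup>2 = (norm (1 - qcnj a * q))\<^sup>2"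
    by (simp only: norm_one_minus_square norm_mult norm_qcnj qRe_qcnj_mult mult.commute)
  thus ?thesis by simp
qed

text \<open>The distance function of the disc rests on this identity: the excess of the denominator over
  the numerator of a Moebius transformation factors into the two conformal weights.\<close>

lemma norm_denominator_square:
  "(norm (1 - qcnj a * q))\<^sup>2 = (norm (q - a))\<^sup>2 + (1 - (norm a)\<^sup>2) * (1 - (norm q)\<^sup>2)"
proof -
  have "(norm (q - a))\<^sup>2 = (norm q)\<^sup>2 - 2 * inner a q + (norm a)\<^sup>2"
    unfolding power2_norm_eq_inner by (simp add: inner_diff inner_commute)
  thus ?thesis
    unfolding norm_one_minus_square qRe_qcnj_mult norm_mult norm_qcnj power_mult_distrib
    by (simp add: algebra_simps)
qed

lemma one_minus_norm_disc_moebius: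
  assumes "norm a < 1" "norm q < 1"
  shows "1 - (norm (disc_moebius a q))\<^sup>2
           = (1 - (norm a)\<^sup>2) * (1 - (norm q)\<^sup>2) / (norm (1 - qcnj a * q))\<^sup>2"
proof -
  have "norm (1 - qcnj a * q) \<noteq> 0"
    using one_minus_mult_nonzero[of "qcnj a" q] assms by simp
  moreover have "norm (disc_moebius a q) = norm (q - a) / norm (1 - qcnj a * q)"
    by (simp only: disc_moebius_def norm_mult norm_inverse divide_inverse)
  ultimately have "1 - (norm (disc_moebius a q))\<^sup>2
      = ((norm (1 - qcnj a * q))\<^sup>2 - (norm (q - a))\<^sup>2) / (norm (1 - qcnj a * q))\<^sup>2"
    by (simp only: power_divide diff_divide_distrib) simp
  thus ?thesis by (simp only: norm_denominator_square add_diff_cancel_left')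
qed

lemma norm_square_less_one: "(norm q)\<^sup>2 < 1" if "norm q < 1" for q :: quat
  using that by (simp add: abs_square_less_1)

lemma norm_disc_moebius_less_one:
  assumes "norm a < 1" "norm q < 1"
  shows "norm (disc_moebius a q) < 1"
proof -
  have "0 < 1 - (norm (disc_moebius a q))\<^sup>2"
    unfolding one_minus_norm_disc_moebius[OF assms]
    using one_minus_mult_nonzero[of "qcnj a" q] assms
    by (simp add: norm_square_less_one)
  thus ?thesis by (simp add: abs_square_less_1)
qed

lemma disc_moebius_zero [simp]: "disc_moebius a 0 = - a"
  by (simp add: disc_moebius_def)

text \<open>The products \<open>a * qcnj a\<close> are real, hence central, so the usual computation for complex
  numbers survives noncommutativity.\<close>

lemma disc_moebius_inverse:
  assumes "norm a < 1" "norm q < 1"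
  shows "disc_moebius (- a) (disc_moebius a q) = q"
proof -
  define w where "w = 1 - qcnj a * q"
  define k where "k = 1 - (norm a)\<^sup>2"
  have w: "w \<noteq> 0" using one_minus_mult_nonzero[of "qcnj a" q] assms by (simp add: w_def)
  have k: "k \<noteq> 0" using norm_square_less_one[OF assms(1)] by (simp add: k_def)
  have "q - a + a * w = q - (a * qcnj a) * q" by (simp add: w_def algebra_simps)
  hence 1: "q - a + a * w = k *\<^sub>R q" by (simp add: qcnj_mult_self k_def algebra_simps)
  have 2: "w + qcnj a * (q - a) = k *\<^sub>R 1"
    by (simp add: w_def k_def algebra_simps qcnj_mult_self)
  have "disc_moebius a q + a = (q - a + a * w) * inverse w"
    using w by (simp add: disc_moebius_def w_def[symmetric] algebra_simps)
  hence 3: "disc_moebius a q + a = k *\<^sub>R (q * inverse w)" by (simp add: 1)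
  have "1 + qcnj a * disc_moebius a q = (w + qcnj a * (q - a)) * inverse w"
    using w by (simp add: disc_moebius_def w_def[symmetric] algebra_simps)
  hence 4: "1 + qcnj a * disc_moebius a q = k *\<^sub>R inverse w" by (simp add: 2)
  show ?thesis
    unfolding disc_moebius_def[of "- a"] using k w
    by (simp add: 3 4 mult.assoc inverse_scaleR_distrib)
qed

text \<open>Differentiating the inverse puts \<open>h\<close> between two factors. The left one simplifies because
  \<open>qcnj a\<close> can be moved through: \<open>(1 - qcnj a * q) * qcnj a = qcnj a * (1 - q * qcnj a)\<close>. Hence the
  derivative is a similarity.\<close>

lemma has_derivative_disc_moebius:
  assumes "norm a < 1" "norm q < 1"
  shows "(disc_moebius a has_derivative
           (\<lambda>h. (1 - (norm a)\<^sup>2) *\<^sub>R (inverse (1 - q * qcnj a) * h * inverse (1 - qcnj a * q)))) (at q)"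
proof -
  define w where "w = 1 - qcnj a * q"
  define w' where "w' = 1 - q * qcnj a"
  have w: "w \<noteq> 0" using one_minus_mult_nonzero[of "qcnj a" q] assms by (simp add: w_def)
  have w': "w' \<noteq> 0" using one_minus_mult_nonzero[of q "qcnj a"] assms by (simp add: w'_def)
  have "((\<lambda>q. (q - a) * inverse (1 - qcnj a * q)) has_derivative
     (\<lambda>h. (q - a) * (- (inverse w * (- (qcnj a * h)) * inverse w)) + h * inverse w)) (at q)"
    unfolding w_def by (rule derivative_eq_intros refl | use w[unfolded w_def] in simp)+
  moreover have "(q - a) * (- (inverse w * (- (qcnj a * h)) * inverse w)) + h * inverse w
      = (1 - (norm a)\<^sup>2) *\<^sub>R (inverse w' * h * inverse w)" for h
  proof -
    have "w * qcnj a = qcnj a * w'" by (simp add: w_def w'_def algebra_simps)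
    hence "inverse w * (w * qcnj a) * inverse w' = inverse w * (qcnj a * w') * inverse w'" by simp
    hence 1: "inverse w * qcnj a = qcnj a * inverse w'"
      using w w' by (simp add: mult.assoc) (metis left_inverse mult.assoc mult_1_left)
    have 2: "w' + (q - a) * qcnj a = (1 - (norm a)\<^sup>2) *\<^sub>R 1"
      by (simp add: w'_def algebra_simps qcnj_mult_self)
    have "1 + (q - a) * (inverse w * qcnj a) = (w' + (q - a) * qcnj a) * inverse w'"
      unfolding 1 using w' by (simp add: algebra_simps)
    also have "\<dots> = (1 - (norm a)\<^sup>2) *\<^sub>R inverse w'" unfolding 2 by simp
    finally have 3: "1 + (q - a) * (inverse w * qcnj a) = (1 - (norm a)\<^sup>2) *\<^sub>R inverse w'" .
    have "(q - a) * (- (inverse w * (- (qcnj a * h)) * inverse w)) + h * inverse w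
       = (1 + (q - a) * (inverse w * qcnj a)) * h * inverse w"
      by (simp add: distrib_right mult.assoc)
    thus ?thesis unfolding 3 by (simp add: mult.assoc)
  qed
  ultimately show ?thesis
    unfolding disc_moebius_def[abs_def] w_def[symmetric] w'_def[symmetric] by simp
qed

text \<open>The scaling factor of the derivative is \<open>(1 - (norm a)\<^sup>2) / (norm (1 - qcnj a * q))\<^sup>2\<close>, and
  this is also the factor by which \<open>1 - (norm q)\<^sup>2\<close> changes.\<close>

lemma poincare_metric_disc_moebius:
  assumes "norm a < 1" "norm q < 1"
  shows "poincare_metric (disc_moebius a q)
           ((1 - (norm a)\<^sup>2) *\<^sub>R (inverse (1 - q * qcnj a) * h * inverse (1 - qcnj a * q)))
         = poincare_metric q h"
proof -
  have n: "norm (1 - qcnj a * q) \<noteq> 0"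
    using one_minus_mult_nonzero[of "qcnj a" q] assms by simp
  have "norm ((1 - (norm a)\<^sup>2) *\<^sub>R (inverse (1 - q * qcnj a) * h * inverse (1 - qcnj a * q)))
      = (1 - (norm a)\<^sup>2) * norm h / (norm (1 - qcnj a * q))\<^sup>2"
    using norm_square_less_one[OF assms(1)]
    by (simp only: norm_mult norm_inverse norm_denominator_commute norm_scaleR)
       (simp add: divide_inverse power2_eq_square)
  thus ?thesis
    unfolding poincare_metric_def one_minus_norm_disc_moebius[OF assms]
    using n norm_square_less_one[OF assms(1)] by simp
qed

section \<open>The integrated distance\<close>

text \<open>The Henstock-Kurzweil integral recovers the increment from any derivative, even one that is
  unbounded near an exceptional point. When the integral of \<open>g\<close> is finite, the derivative is moreover
  absolutely integrable, so that its integral is bounded by the Lebesgue integral of its absolute value.\<close>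

lemma increment_le_nn_integral:
  fixes f f' g :: "real \<Rightarrow> real"
  assumes "a \<le> b" "continuous_on {a..b} f" "finite S"
    and deriv: "\<And>t. t \<in> {a<..<b} - S \<Longrightarrow> (f has_real_derivative f' t) (at t)"
    and bound: "\<And>t. t \<in> {a<..<b} - S \<Longrightarrow> \<bar>f' t\<bar> \<le> g t"
  shows "ennreal (f b - f a) \<le> (\<integral>\<^sup>+t\<in>{a..b}. ennreal (g t) \<partial>lborel)"
proof (cases "(\<integral>\<^sup>+t\<in>{a..b}. ennreal (g t) \<partial>lborel) = \<infinity>")
  case False
  \<comment> \<open>Making the derivative vanish on the exceptional set turns the bound by \<open>g\<close> into a pointwise one.\<close>
  define h where "h t = (if t \<in> {a<..<b} - S then f' t else 0)" for t
  have h: "(h has_integral (f b - f a)) {a..b}"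
    by (rule fundamental_theorem_of_calculus_interior_strong[of S])
       (use assms in \<open>auto simp: h_def has_real_derivative_iff_has_vector_derivative[symmetric]\<close>)
  have meas: "h \<in> borel_measurable (lebesgue_on {a..b})"
    using h by (intro integrable_imp_measurable) auto
  have "(\<integral>\<^sup>+t. ennreal (norm (h t)) \<partial>lebesgue_on {a..b})
      = (\<integral>\<^sup>+t. ennreal (norm (h t)) * indicator {a..b} t \<partial>lborel)"
    by (simp add: nn_integral_restrict_space nn_integral_completion)
  also have "\<dots> \<le> (\<integral>\<^sup>+t\<in>{a..b}. ennreal (g t) \<partial>lborel)"
    by (intro nn_integral_mono) (auto simp: h_def indicator_def intro!: ennreal_leI bound)
  finally have le: "(\<integral>\<^sup>+t. ennreal (norm (h t)) \<partial>lebesgue_on {a..b}) \<le> \<dots>" .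
  have int: "integrable (lebesgue_on {a..b}) h"
    using meas le False by (intro integrableI_bounded) (auto simp: top.not_eq_extremum intro: le_less_trans)
  have "f b - f a = integral\<^sup>L (lebesgue_on {a..b}) h"
    using h lebesgue_integral_eq_integral[OF int] by (simp add: integral_unique)
  hence "ennreal (f b - f a) \<le> ennreal (norm (integral\<^sup>L (lebesgue_on {a..b}) h))"
    by (intro ennreal_leI) simp
  also have "\<dots> \<le> (\<integral>\<^sup>+t. ennreal (norm (h t)) \<partial>lebesgue_on {a..b})"
    by (rule integral_norm_bound_ennreal[OF int])
  finally show ?thesis using le by simp
qed simp

text \<open>For \<open>norm u \<le> 1\<close>, the function \<open>artanh (inner q u)\<close> is 1-Lipschitz for the Poincare
  metric, since \<open>1 - (inner q u)\<^sup>2 \<ge> 1 - (norm q)\<^sup>2\<close>. Using a component in place of \<open>norm q\<close>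
  keeps the function differentiable at the origin.\<close>

lemma artanh_le_poincare_length:
  assumes q1: "norm q1 < 1" and \<gamma>: "\<gamma> \<in> arcs_joining q1 q2"
  shows "ennreal (artanh (norm (disc_moebius q1 q2))) \<le> poincare_length \<gamma>"
proof -
  \<comment> \<open>The direction of the end point: the component along \<open>u\<close> of the arc's image under the isometry
    goes from 0 to the full norm of the end point.\<close>
  define u where "u = sgn (disc_moebius q1 q2)"
  have u: "norm u \<le> 1" by (simp add: u_def norm_sgn)
  define f where "f t = artanh (inner (disc_moebius q1 (\<gamma> t)) u)" for t
  from \<gamma> obtain S where cont: "continuous_on {0..1} \<gamma>" and S: "finite S"
    and diff: "\<And>t. t \<in> {0..1} - S \<Longrightarrow> \<gamma> differentiable (at t within {0..1})"
    and disc: "\<And>t. t \<in> {0..1} \<Longrightarrow> norm (\<gamma> t) < 1" and ends: "\<gamma> 0 = q1" "\<gamma> 1 = q2"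
    by (auto simp: arcs_joining_def piecewise_differentiable_on_def path_image_def
          pathstart_def pathfinish_def image_subset_iff)
  have inner_le: "\<bar>inner x u\<bar> \<le> norm x" for x
    using Cauchy_Schwarz_ineq2[of x u] mult_left_mono[OF u norm_ge_zero[of x]] by simp
  have inner_less: "\<bar>inner (disc_moebius q1 (\<gamma> t)) u\<bar> < 1" if "t \<in> {0..1}" for t
    using inner_le[of "disc_moebius q1 (\<gamma> t)"] norm_disc_moebius_less_one[OF q1 disc[OF that]] by linarith
  have contf: "continuous_on {0..1} f"
  proof -
    have "continuous_on (ball 0 1) (disc_moebius q1)"
      by (intro continuous_at_imp_continuous_on ballI has_derivative_continuous)
         (rule has_derivative_disc_moebius[OF q1], simp)
    hence "continuous_on {0..1} (\<lambda>t. disc_moebius q1 (\<gamma> t))"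
      by (rule continuous_on_compose2[OF _ cont]) (use disc in auto)
    thus ?thesis unfolding f_def
      by (intro continuous_on_artanh' continuous_intros)
         (use inner_less in \<open>auto simp: abs_less_iff\<close>)
  qed
  define D where "D t = (1 - (norm q1)\<^sup>2) *\<^sub>R (inverse (1 - \<gamma> t * qcnj q1)
      * vector_derivative \<gamma> (at t within {0..1}) * inverse (1 - qcnj q1 * \<gamma> t))" for t
  define f' where "f' t = inner (D t) u / (1 - (inner (disc_moebius q1 (\<gamma> t)) u)\<^sup>2)" for t
  have "ennreal (f 1 - f 0) \<le> (\<integral>\<^sup>+t\<in>{0..1}.
      ennreal (poincare_metric (\<gamma> t) (vector_derivative \<gamma> (at t within {0..1}))) \<partial>lborel)"
  proof (rule increment_le_nn_integral[where f' = f' and S = S])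
    fix t :: real assume t: "t \<in> {0<..<1} - S"
    hence t': "t \<in> {0..1} - S" "t \<in> {0..1}" by auto
    have "(\<gamma> has_vector_derivative vector_derivative \<gamma> (at t within {0..1})) (at t within {0..1})"
      using diff[OF t'(1)] by (simp add: vector_derivative_works)
    hence "(\<gamma> has_vector_derivative vector_derivative \<gamma> (at t within {0..1})) (at t)"
      using t by (simp add: at_within_Icc_at)
    from has_derivative_compose[OF this[unfolded has_vector_derivative_def]
        has_derivative_disc_moebius[OF q1 disc[OF t'(2)]]]
    have "((\<lambda>t. disc_moebius q1 (\<gamma> t)) has_vector_derivative D t) (at t)"
      by (simp add: has_vector_derivative_def D_def mult.commute)
    hence "((\<lambda>t. inner (disc_moebius q1 (\<gamma> t)) u) has_vector_derivative inner (D t) u) (at t)"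
      by (rule bounded_linear.has_vector_derivative[OF bounded_linear_inner_left])
    hence "((\<lambda>t. inner (disc_moebius q1 (\<gamma> t)) u) has_real_derivative inner (D t) u) (at t)"
      by (simp add: has_real_derivative_iff_has_vector_derivative)
    from DERIV_chain2[OF artanh_real_has_field_derivative[OF inner_less[OF t'(2)]] this]
    show "(f has_real_derivative f' t) (at t)"
      by (simp add: f_def[abs_def] f'_def)
    have *: "(inner (disc_moebius q1 (\<gamma> t)) u)\<^sup>2 \<le> (norm (disc_moebius q1 (\<gamma> t)))\<^sup>2"
      using inner_le abs_le_square_iff[of "inner (disc_moebius q1 (\<gamma> t)) u" "norm (disc_moebius q1 (\<gamma> t))"]
      by simp
    have **: "(norm (disc_moebius q1 (\<gamma> t)))\<^sup>2 < 1"
      by (intro norm_square_less_one norm_disc_moebius_less_one q1 disc t')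
    have "\<bar>f' t\<bar> = \<bar>inner (D t) u\<bar> / (1 - (inner (disc_moebius q1 (\<gamma> t)) u)\<^sup>2)"
      using * ** by (simp add: f'_def abs_divide)
    also have "\<dots> \<le> poincare_metric (disc_moebius q1 (\<gamma> t)) (D t)"
      unfolding poincare_metric_def by (intro frac_le) (use * ** inner_le in auto)
    also have "\<dots> = poincare_metric (\<gamma> t) (vector_derivative \<gamma> (at t within {0..1}))"
      unfolding D_def by (rule poincare_metric_disc_moebius[OF q1 disc[OF t'(2)]])
    finally show "\<bar>f' t\<bar> \<le> poincare_metric (\<gamma> t) (vector_derivative \<gamma> (at t within {0..1}))" .
  qed (use contf S in auto)
  moreover have "f 0 = 0" by (simp add: f_def ends disc_moebius_def)
  moreover have "inner (disc_moebius q1 q2) u = norm (disc_moebius q1 q2)"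
    by (cases "disc_moebius q1 q2 = 0")
       (simp_all add: u_def sgn_div_norm dot_square_norm power2_eq_square)
  hence "f 1 = artanh (norm (disc_moebius q1 q2))" by (simp add: f_def ends)
  ultimately show ?thesis by (simp add: poincare_length_def)
qed

text \<open>The inverse Moebius transformation carries the radius from 0 to \<open>z\<close>, whose length is the
  integral of \<open>norm z / (1 - (t * norm z)\<^sup>2)\<close>, to an arc that attains the infimum.\<close>

lemma geodesic_arc:
  fixes q1 q2 :: quat
  assumes q1: "norm q1 < 1" and q2: "norm q2 < 1"
  defines "z \<equiv> disc_moebius q1 q2"
  defines "\<gamma> \<equiv> (\<lambda>t. disc_moebius (- q1) (t *\<^sub>R z))"
  shows "\<gamma> \<in> arcs_joining q1 q2" and "poincare_length \<gamma> = ennreal (artanh (norm z))"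
proof -
  have z: "norm z < 1" unfolding z_def by (rule norm_disc_moebius_less_one[OF q1 q2])
  have q1': "norm (- q1) < 1" using q1 by simp
  have tz: "norm (t *\<^sub>R z) < 1" if "t \<in> {0..1}" for t
    using that z mult_left_le_one_le[of "norm z" t] by simp
  define D where "D t = (1 - (norm (- q1))\<^sup>2) *\<^sub>R (inverse (1 - t *\<^sub>R z * qcnj (- q1))
      * z * inverse (1 - qcnj (- q1) * (t *\<^sub>R z)))" for t
  have deriv: "(\<gamma> has_vector_derivative D t) (at t)" if "t \<in> {0..1}" for t
  proof -
    have "((\<lambda>t. t *\<^sub>R z) has_derivative (\<lambda>h. h *\<^sub>R z)) (at t)"
      by (auto intro!: derivative_eq_intros)
    from has_derivative_compose[OF this has_derivative_disc_moebius[OF q1' tz[OF that]]]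
    show ?thesis
      unfolding has_vector_derivative_def \<gamma>_def D_def by (simp add: mult.commute)
  qed
  have deriv': "(\<gamma> has_vector_derivative D t) (at t within {0..1})" if "t \<in> {0..1}" for t
    using deriv[OF that] by (rule has_vector_derivative_at_within)
  have "\<gamma> piecewise_differentiable_on {0..1}"
    unfolding piecewise_differentiable_on_def
    using deriv'
    by (auto intro!: exI[of _ "{}"] continuous_on_vector_derivative differentiableI_vector
        simp del: atLeastAtMost_iff)
  thus "\<gamma> \<in> arcs_joining q1 q2"
    using norm_disc_moebius_less_one[OF q1' tz] disc_moebius_inverse[OF q1 q2]
    by (auto simp: arcs_joining_def path_image_def pathstart_def pathfinish_def \<gamma>_def z_def)
  have speed: "poincare_metric (\<gamma> t) (vector_derivative \<gamma> (at t within {0..1}))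
      = norm z / (1 - (t * norm z)\<^sup>2)" if "t \<in> {0..1}" for t
  proof -
    have "vector_derivative \<gamma> (at t within {0..1}) = D t"
      using that using vector_derivative_within_cbox[of 0 1 t \<gamma> "D t"] deriv'[OF that] by simp
    hence "poincare_metric (\<gamma> t) (vector_derivative \<gamma> (at t within {0..1})) = poincare_metric (t *\<^sub>R z) z"
      unfolding \<gamma>_def D_def by (simp only: poincare_metric_disc_moebius[OF q1' tz[OF that]])
    thus ?thesis by (simp add: poincare_metric_def power_mult_distrib)
  qed
  have "poincare_length \<gamma> = (\<integral>\<^sup>+t. ennreal (norm z / (1 - (t * norm z)\<^sup>2)) * indicator {0..1} t \<partial>lborel)"
    unfolding poincare_length_def
    by (intro nn_integral_cong) (auto simp: indicator_def speed)
  also have "\<dots> = ennreal (artanh (1 * norm z) - artanh (0 * norm z))"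
  proof (rule nn_integral_FTC_Icc)
    fix t :: real assume t: "t \<in> {0..1}"
    have abs: "\<bar>t * norm z\<bar> < 1" using tz[of t] t by simp
    show "((\<lambda>t. artanh (t * norm z)) has_real_derivative norm z / (1 - (t * norm z)\<^sup>2)) (at t)"
      by (rule DERIV_cong[OF DERIV_chain2[OF artanh_real_has_field_derivative[OF abs]
              DERIV_cmult_right[OF DERIV_ident]]]) simp
    show "0 \<le> norm z / (1 - (t * norm z)\<^sup>2)"
      using abs abs_square_less_1[of "t * norm z"] by auto
  qed auto
  finally show "poincare_length \<gamma> = ennreal (artanh (norm z))" by simp
qed

lemma integrated_dist_eq_artanh:
  assumes "norm q1 < 1" and "norm q2 < 1"
  shows "integrated_dist q1 q2 = ennreal (artanh (norm (disc_moebius q1 q2)))"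
proof (rule antisym)
  show "integrated_dist q1 q2 \<le> ennreal (artanh (norm (disc_moebius q1 q2)))"
    unfolding integrated_dist_def geodesic_arc(2)[OF assms, symmetric]
    by (rule INF_lower[OF geodesic_arc(1)[OF assms]])
  show "ennreal (artanh (norm (disc_moebius q1 q2))) \<le> integrated_dist q1 q2"
    unfolding integrated_dist_def
    by (rule INF_greatest[OF artanh_le_poincare_length[OF assms(1)]])
qed

section \<open>Cross-ratios of points arranged cyclically\<close>

lemma circle_frame_norm:
  assumes "circle_frame r u v"
  shows "(norm (x *\<^sub>R u + y *\<^sub>R v))\<^sup>2 = x\<^sup>2 + y\<^sup>2"
proof -
  have "inner u u = 1" "inner v v = 1" "inner u v = 0" "inner v u = 0"
    using assms by (auto simp: circle_frame_def orthogonal_def norm_eq_1 inner_commute)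
  thus ?thesis
    unfolding power2_norm_eq_inner by (simp add: inner_simps power2_eq_square)
qed

text \<open>The chord between the parameters \<open>s\<close> and \<open>t\<close> of a circle is parallel to the tangent at the
  parameter \<open>(s + t) / 2\<close>.\<close>

definition chord_direction :: "quat \<Rightarrow> quat \<Rightarrow> real \<Rightarrow> quat" where
  "chord_direction u v m = - sin m *\<^sub>R u + cos m *\<^sub>R v"

lemma circle_chord:
  "circle_param c r u v s - circle_param c r u v t
     = (2 * r * sin ((s - t) / 2)) *\<^sub>R chord_direction u v ((s + t) / 2)"
proof -
  have 1: "cos s - cos t = - 2 * sin ((s - t) / 2) * sin ((s + t) / 2)"
    using cos_diff_cos[of t s] minus_diff_eq[of "cos t" "cos s"] by (simp add: add.commute[of t s] mult.commute mult.left_commute)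
  have 2: "sin s - sin t = 2 * sin ((s - t) / 2) * cos ((s + t) / 2)"
    by (rule sin_diff_sin)
  have "circle_param c r u v s - circle_param c r u v t
      = (r * (cos s - cos t)) *\<^sub>R u + (r * (sin s - sin t)) *\<^sub>R v"
    by (simp add: circle_param_def algebra_simps)
  thus ?thesis unfolding 1 2 by (simp add: chord_direction_def algebra_simps)
qed

lemma norm_chord_direction:
  assumes "circle_frame r u v"
  shows "norm (chord_direction u v m) = 1"
proof -
  have "(norm (chord_direction u v m))\<^sup>2 = 1"
    using circle_frame_norm[OF assms, of "- sin m" "cos m"] by (simp add: chord_direction_def)
  thus ?thesis by (simp add: abs_square_eq_1)
qed

text \<open>Left multiplication by \<open>v * qcnj u\<close>, a unit quaternion with real part \<open>inner u v = 0\<close>, is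
  the rotation by a right angle in the plane of \<open>u\<close> and \<open>v\<close>. It plays the role of the imaginary unit.\<close>

lemma circle_frame_rotation:
  assumes "circle_frame r u v"
  shows "v * qcnj u * u = v" and "v * qcnj u * v = - u" and "v * qcnj u * (v * qcnj u) = - 1"
proof -
  have uv: "norm u = 1" "norm v = 1" "inner u v = 0"
    using assms by (auto simp: circle_frame_def orthogonal_def)
  have "v * qcnj u = - (u * qcnj v)"
    using uv(3) by (simp add: quat_eq_iff inner_quat_def algebra_simps)
  thus v: "v * qcnj u * v = - u" using uv by (simp add: mult.assoc qcnj_mult_self)
  show "v * qcnj u * u = v" using uv by (simp add: mult.assoc qcnj_mult_self)
  have "v * qcnj u * (v * qcnj u) = v * qcnj u * v * qcnj u" by (simp add: mult.assoc)
  thus "v * qcnj u * (v * qcnj u) = - 1" using uv by (simp add: v qcnj_mult_self)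
qed

lemma chord_direction_quotient:
  assumes fr: "circle_frame r u v"
  shows "chord_direction u v m * inverse (chord_direction u v n)
           = of_real (cos (m - n)) + of_real (sin (m - n)) * (v * qcnj u)"
proof -
  have s: "sin m = sin (m - n) * cos n + cos (m - n) * sin n"
    using sin_add[of "m - n" n] by simp
  have c: "cos m = cos (m - n) * cos n - sin (m - n) * sin n"
    using cos_add[of "m - n" n] by simp
  have "(of_real (cos (m - n)) + of_real (sin (m - n)) * (v * qcnj u)) * chord_direction u v n
      = cos (m - n) *\<^sub>R chord_direction u v n
        + sin (m - n) *\<^sub>R ((v * qcnj u) * chord_direction u v n)"
    by (simp add: of_real_def distrib_right)
  also have "(v * qcnj u) * chord_direction u v n = - sin n *\<^sub>R v - cos n *\<^sub>R u"
    by (simp add: chord_direction_def distrib_left right_diff_distrib circle_frame_rotation[OF fr])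
  also have "cos (m - n) *\<^sub>R chord_direction u v n + sin (m - n) *\<^sub>R (- sin n *\<^sub>R v - cos n *\<^sub>R u)
      = - (sin (m - n) * cos n + cos (m - n) * sin n) *\<^sub>R u
        + (cos (m - n) * cos n - sin (m - n) * sin n) *\<^sub>R v"
    by (simp add: chord_direction_def algebra_simps)
  also have "\<dots> = chord_direction u v m"
    by (simp only: s[symmetric] c[symmetric] chord_direction_def)
  finally have "chord_direction u v m
      = (of_real (cos (m - n)) + of_real (sin (m - n)) * (v * qcnj u)) * chord_direction u v n" ..
  moreover have "chord_direction u v n \<noteq> 0"
    using norm_chord_direction[OF fr, of n] by auto
  ultimately show ?thesis by (simp add: mult.assoc)
qed

text \<open>The quotients of chord directions are \<open>exp (x * J)\<close> and \<open>exp (- x * J)\<close> for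
  \<open>J = v * qcnj u\<close> and the same angle \<open>x\<close>, so they cancel and only the signed chord lengths remain.\<close>

lemma circle_cross_ratio:
  fixes c u v :: quat and r t1 t2 t3 t4 :: real
  assumes fr: "circle_frame r u v"
  defines "q \<equiv> circle_param c r u v"
  shows "cross_ratio (q t1) (q t2) (q t3) (q t4)
    = of_real (sin ((t3 - t1) / 2) * sin ((t4 - t2) / 2) / (sin ((t4 - t1) / 2) * sin ((t3 - t2) / 2)))"
proof -
  let ?W = "chord_direction u v"
  let ?a = "\<lambda>s t. 2 * r * sin ((s - t) / 2)"
  let ?J = "v * qcnj u"
  define x where "x = (t3 - t4) / 2"
  have r: "r \<noteq> 0" using fr by (simp add: circle_frame_def)
  have "(of_real (cos x) + of_real (sin x) * ?J) * (of_real (cos x) - of_real (sin x) * ?J)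
      = of_real ((cos x)\<^sup>2) - of_real ((sin x)\<^sup>2) * (?J * ?J)"
    by (simp add: of_real_def algebra_simps power2_eq_square)
  hence E: "(of_real (cos x) + of_real (sin x) * ?J) * (of_real (cos x) - of_real (sin x) * ?J) = 1"
    unfolding circle_frame_rotation(3)[OF fr] using cos_squared_eq[of x] by (simp flip: of_real_add of_real_power)
  have 1: "?W ((t1 + t3) / 2) * inverse (?W ((t1 + t4) / 2)) = of_real (cos x) + of_real (sin x) * ?J"
    unfolding chord_direction_quotient[OF fr] by (simp add: x_def diff_divide_distrib add_divide_distrib)
  have "(t2 + t4) / 2 - (t2 + t3) / 2 = - x" by (simp add: x_def field_simps)
  hence 2: "?W ((t2 + t4) / 2) * inverse (?W ((t2 + t3) / 2)) = of_real (cos x) - of_real (sin x) * ?J"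
    unfolding chord_direction_quotient[OF fr] by simp
  have "cross_ratio (q t1) (q t2) (q t3) (q t4)
     = (?a t1 t3 * inverse (?a t1 t4) * ?a t2 t4 * inverse (?a t2 t3)) *\<^sub>R
       (?W ((t1 + t3) / 2) * inverse (?W ((t1 + t4) / 2)) * (?W ((t2 + t4) / 2) * inverse (?W ((t2 + t3) / 2))))"
    by (simp only: cross_ratio_def q_def circle_chord inverse_scaleR_distrib
         mult_scaleR_left mult_scaleR_right scaleR_scaleR mult.assoc)
       (simp add: ac_simps)
  also have "\<dots> = of_real (?a t1 t3 * inverse (?a t1 t4) * ?a t2 t4 * inverse (?a t2 t3))"
    unfolding 1 2 E by (simp add: of_real_def)
  also have "?a t1 t3 * inverse (?a t1 t4) * ?a t2 t4 * inverse (?a t2 t3)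
     = ?a t3 t1 * ?a t4 t2 / (?a t4 t1 * ?a t3 t2)"
  proof -
    have neg: "?a s t = - ?a t s" for s t
      using sin_minus[of "(t - s) / 2"] by (simp add: minus_divide_left del: sin_minus)
    have "a * inverse b * c * inverse d = (- a) * (- c) / ((- b) * (- d))" for a b c d :: real
      by (simp add: divide_inverse)
    thus ?thesis
      unfolding neg[of t3 t1] neg[of t4 t2] neg[of t4 t1] neg[of t3 t2] .
  qed
  also have "\<dots> = sin ((t3 - t1) / 2) * sin ((t4 - t2) / 2) / (sin ((t4 - t1) / 2) * sin ((t3 - t2) / 2))"
    using r by simp
  finally show ?thesis .
qed

text \<open>Ptolemy's theorem for the four points of a circle at the angles \<open>t1\<close>, \<open>t2\<close>, \<open>t3\<close>, \<open>t4\<close>.\<close>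

lemma ptolemy_sin:
  fixes t1 t2 t3 t4 :: real
  shows "sin ((t3 - t1) / 2) * sin ((t4 - t2) / 2)
    = sin ((t4 - t1) / 2) * sin ((t3 - t2) / 2) + sin ((t2 - t1) / 2) * sin ((t4 - t3) / 2)"
proof -
  have *: "sin (a + b) * sin (b + c) = sin (a + b + c) * sin b + sin a * sin c" for a b c :: real
    unfolding sin_times_sin by (simp add: algebra_simps diff_divide_distrib add_divide_distrib)
  show ?thesis
    using *[of "(t2 - t1) / 2" "(t3 - t2) / 2" "(t4 - t3) / 2"]
    by (simp add: add_divide_distrib[symmetric])
qed

lemma real_multiples_cross_ratio:
  assumes "norm u = 1"
  shows "cross_ratio (t1 *\<^sub>R u) (t2 *\<^sub>R u) (t3 *\<^sub>R u) (t4 *\<^sub>R u)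
    = of_real ((t3 - t1) * (t4 - t2) / ((t4 - t1) * (t3 - t2)))"
proof -
  have u: "u \<noteq> 0" using assms by auto
  have "cross_ratio (t1 *\<^sub>R u) (t2 *\<^sub>R u) (t3 *\<^sub>R u) (t4 *\<^sub>R u)
      = ((t1 - t3) * inverse (t1 - t4) * (t2 - t4) * inverse (t2 - t3)) *\<^sub>R
          (u * inverse u * (u * inverse u))"
    by (simp only: cross_ratio_def scaleR_left_diff_distrib[symmetric] inverse_scaleR_distrib
         mult_scaleR_left mult_scaleR_right scaleR_scaleR mult.assoc)
       (simp add: ac_simps)
  also have "\<dots> = of_real ((t1 - t3) * inverse (t1 - t4) * (t2 - t4) * inverse (t2 - t3))"
    using u by (simp add: of_real_def)
  also have "(t1 - t3) * inverse (t1 - t4) * (t2 - t4) * inverse (t2 - t3)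
      = (t3 - t1) * (t4 - t2) / ((t4 - t1) * (t3 - t2))"
  proof -
    have "a * inverse b * c * inverse d = (- a) * (- c) / ((- b) * (- d))" for a b c d :: real
      by (simp add: divide_inverse)
    from this[of "t1 - t3" "t1 - t4" "t2 - t4" "t2 - t3"] show ?thesis by simp
  qed
  finally show ?thesis .
qed

text \<open>By Ptolemy's theorem on circles, and by its degenerate form on lines, the product of the
  diagonals exceeds the product of one pair of opposite sides by the product of the other pair.\<close>

lemma arranged_cyclically_cross_ratio_gt_one:
  assumes "arranged_cyclically L q1 q2 q3 q4"
  shows "norm (cross_ratio q1 q2 q3 q4) > 1"
  using assms unfolding arranged_cyclically_def
proof
  assume "cyclic_on_circle L q1 q2 q3 q4"
  then obtain c r u v t1 t2 t3 t4 where fr: "circle_frame r u v"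
    and t: "t1 < t2" "t2 < t3" "t3 < t4" "t4 < t1 + 2 * pi"
    and q: "q1 = circle_param c r u v t1" "q2 = circle_param c r u v t2"
        "q3 = circle_param c r u v t3" "q4 = circle_param c r u v t4"
    unfolding cyclic_on_circle_def by blast
  have pos: "sin ((t4 - t1) / 2) > 0" "sin ((t3 - t2) / 2) > 0"
     "sin ((t2 - t1) / 2) > 0" "sin ((t4 - t3) / 2) > 0"
    by (rule sin_gt_zero; use t in simp)+
  hence "1 < sin ((t3 - t1) / 2) * sin ((t4 - t2) / 2) / (sin ((t4 - t1) / 2) * sin ((t3 - t2) / 2))"
    by (subst ptolemy_sin) simp
  thus ?thesis unfolding q circle_cross_ratio[OF fr] norm_of_real by linarith
next
  assume "cyclic_on_diameter L q1 q2 q3 q4"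
  then obtain u t1 t2 t3 t4 where u: "norm u = 1"
    and q: "q1 = t1 *\<^sub>R u" "q2 = t2 *\<^sub>R u" "q3 = t3 *\<^sub>R u" "q4 = t4 *\<^sub>R u"
    and t: "t1 < t2 \<and> t2 < t3 \<and> t3 < t4 \<or> t2 < t3 \<and> t3 < t4 \<and> t4 < t1 \<or>
         t3 < t4 \<and> t4 < t1 \<and> t1 < t2 \<or> t4 < t1 \<and> t1 < t2 \<and> t2 < t3"
    unfolding cyclic_on_diameter_def by blast
  have nz: "(t4 - t1) * (t3 - t2) \<noteq> 0" using t by auto
  have "(t3 - t1) * (t4 - t2) = (t4 - t1) * (t3 - t2) + (t2 - t1) * (t4 - t3)"
    by (simp add: algebra_simps)
  hence "(t3 - t1) * (t4 - t2) / ((t4 - t1) * (t3 - t2))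
      = 1 + (t2 - t1) * (t4 - t3) / ((t4 - t1) * (t3 - t2))"
    using nz by (simp add: add_divide_distrib)
  moreover have "(t2 - t1) * (t4 - t3) / ((t4 - t1) * (t3 - t2)) > 0"
    using t by (auto simp: zero_less_divide_iff zero_less_mult_iff mult_less_0_iff)
  ultimately show ?thesis unfolding q real_multiples_cross_ratio[OF u] norm_of_real by linarith
qed

lemma norm_cross_ratio_swap:
  "norm (cross_ratio q1 q2 q4 q3) = inverse (norm (cross_ratio q1 q2 q3 q4))"
  unfolding cross_ratio_def norm_mult norm_inverse by simp

text \<open>Exchanging the two ends inverts the norm of the cross-ratio, so at most one naming of the ends
  makes it larger than 1. Hence the cyclic order determines the naming, and the description that
  defines the distance is unique.\<close>

lemma poincare_dist_eqI:
  assumes "q1 \<noteq> q2" and ends: "line_ends q1 q2 = {q3, q4}"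
    and arr: "arranged_cyclically (noneuclidean_line q1 q2) q1 q2 q3 q4"
    and x: "0 < x" "cross_ratio q1 q2 q3 q4 = of_real x"
  shows "poincare_dist q1 q2 = ln x / 2"
proof -
  have "(THE d. \<exists>q3 q4 x. line_ends q1 q2 = {q3, q4} \<and>
             arranged_cyclically (noneuclidean_line q1 q2) q1 q2 q3 q4 \<and>
             0 < x \<and> cross_ratio q1 q2 q3 q4 = of_real x \<and> d = 1 / 2 * ln x) = ln x / 2"
  proof (rule the_equality)
    show "\<exists>q3 q4 y. line_ends q1 q2 = {q3, q4} \<and>
             arranged_cyclically (noneuclidean_line q1 q2) q1 q2 q3 q4 \<and>
             0 < y \<and> cross_ratio q1 q2 q3 q4 = of_real y \<and> ln x / 2 = 1 / 2 * ln y"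
      by (intro exI[of _ q3] exI[of _ q4] exI[of _ x]) (use ends arr x in simp)
  next
    fix d assume "\<exists>q3 q4 x. line_ends q1 q2 = {q3, q4} \<and>
             arranged_cyclically (noneuclidean_line q1 q2) q1 q2 q3 q4 \<and>
             0 < x \<and> cross_ratio q1 q2 q3 q4 = of_real x \<and> d = 1 / 2 * ln x"
    then obtain p3 p4 y where p: "line_ends q1 q2 = {p3, p4}"
       and arr': "arranged_cyclically (noneuclidean_line q1 q2) q1 q2 p3 p4"
       and y: "cross_ratio q1 q2 p3 p4 = of_real y" and d: "d = 1 / 2 * ln y" by blast
    have "\<not> (p3 = q4 \<and> p4 = q3)"
    proof
      assume sw: "p3 = q4 \<and> p4 = q3"
      have "1 < norm (cross_ratio q1 q2 q3 q4)" "1 < inverse (norm (cross_ratio q1 q2 q3 q4))"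
        using arranged_cyclically_cross_ratio_gt_one[OF arr]
          arranged_cyclically_cross_ratio_gt_one[OF arr'] sw
        by (simp_all add: norm_cross_ratio_swap[of q1 q2 q3 q4])
      thus False by (simp add: one_less_inverse_iff)
    qed
    with p ends have "p3 = q3" "p4 = q4" by (auto simp: doubleton_eq_iff)
    with x y have "y = x" by simp
    thus "d = ln x / 2" using d by simp
  qed
  thus ?thesis using assms(1) by (simp add: poincare_dist_def)
qed

text \<open>The hypothesis says that the cross-ratio \<open>P / Q\<close> has the value that
  \<open>(norm (disc_moebius q1 q2))\<^sup>2 = ((P - Q) / (P + Q))\<^sup>2\<close> requires. It is homogeneous in \<open>P\<close> and
  \<open>Q\<close>, which lets the products of side lengths be inserted without dividing.\<close>

lemma half_ln_eq_artanh_disc_moebius: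
  assumes q: "norm q1 < 1" "norm q2 < 1" and PQ: "0 < Q" "Q < P"
    and eq: "(P - Q)\<^sup>2 * ((1 - (norm q1)\<^sup>2) * (1 - (norm q2)\<^sup>2)) = 4 * P * Q * (norm (q2 - q1))\<^sup>2"
  shows "ln (P / Q) / 2 = artanh (norm (disc_moebius q1 q2))"
proof -
  define N where "N = (1 - (norm q1)\<^sup>2) * (1 - (norm q2)\<^sup>2)"
  define M where "M = (norm (q2 - q1))\<^sup>2"
  have N: "N > 0" using q norm_square_less_one by (simp add: N_def)
  have MN: "M + N > 0" using N by (simp add: M_def add_nonneg_pos)
  have eq': "(P - Q)\<^sup>2 * N = 4 * P * Q * M" using eq by (simp add: N_def M_def)
  have "1 - (norm (disc_moebius q1 q2))\<^sup>2 = N / (M + N)"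
    unfolding one_minus_norm_disc_moebius[OF q] norm_denominator_square N_def M_def ..
  hence 1: "(norm (disc_moebius q1 q2))\<^sup>2 = M / (M + N)" using MN by (simp add: field_simps)
  have "M * (P + Q)\<^sup>2 = (P - Q)\<^sup>2 * (M + N)"
    using eq' by (simp add: power2_eq_square algebra_simps)
  hence "M / (M + N) = ((P - Q) / (P + Q))\<^sup>2"
    unfolding power_divide using MN PQ by (subst frac_eq_eq) auto
  with 1 have "(norm (disc_moebius q1 q2))\<^sup>2 = ((P - Q) / (P + Q))\<^sup>2" by (rule trans)
  moreover have "0 \<le> (P - Q) / (P + Q)" using PQ by simp
  ultimately have "norm (disc_moebius q1 q2) = (P - Q) / (P + Q)"
    by (rule power2_eq_imp_eq[OF _ norm_ge_zero])
  moreover have "(1 + (P - Q) / (P + Q)) / (1 - (P - Q) / (P + Q)) = P / Q"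
    using PQ by (simp add: divide_simps)
  ultimately show ?thesis by (simp add: artanh_def)
qed

section \<open>Points on a diameter\<close>

lemma closed_segment_antipodal: "closed_segment (- u) u = (\<lambda>x. x *\<^sub>R u) ` {-1..1}" for u :: quat
proof (intro equalityI subsetI)
  fix q assume "q \<in> closed_segment (- u) u"
  then obtain k where k: "0 \<le> k" "k \<le> 1" "q = (1 - k) *\<^sub>R (- u) + k *\<^sub>R u" by (auto simp: in_segment)
  have "q = (2 * k - 1) *\<^sub>R u" by (simp add: k quat_eq_iff algebra_simps)
  thus "q \<in> (\<lambda>x. x *\<^sub>R u) ` {-1..1}" using k by auto
next
  fix q assume "q \<in> (\<lambda>x. x *\<^sub>R u) ` {-1..1}"
  then obtain x where x: "-1 \<le> x" "x \<le> 1" "q = x *\<^sub>R u" by auto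
  have "q = (1 - (x + 1) / 2) *\<^sub>R (- u) + ((x + 1) / 2) *\<^sub>R u"
    by (simp add: x(3) quat_eq_iff field_simps)
  thus "q \<in> closed_segment (- u) u" using x by (auto simp: in_segment intro!: exI[of _ "(x + 1) / 2"])
qed

text \<open>The sign of \<open>u\<close> is chosen so that the coordinates increase; then \<open>u\<close> itself is the end
  that follows \<open>q2\<close>.\<close>

lemma dependent_pair_multiples:
  fixes q1 q2 :: quat
  assumes "dependent {q1, q2}" "q1 \<noteq> q2"
  obtains u s t where "norm u = 1" "q1 = s *\<^sub>R u" "q2 = t *\<^sub>R u" "s < t"
proof -
  have "\<exists>w s t. norm w = 1 \<and> q1 = s *\<^sub>R w \<and> q2 = t *\<^sub>R w"
  proof (cases "q2 = 0")
    case True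
    thus ?thesis using assms(2)
      by (intro exI[of _ "sgn q1"] exI[of _ "norm q1"] exI[of _ 0]) (simp add: norm_sgn sgn_div_norm)
  next
    case False
    with assms have "q1 \<in> span {q2}"
      using independent_insert[of q1 "{q2}"] by (auto simp: dependent_single)
    then obtain k where "q1 = k *\<^sub>R q2" by (auto simp: span_singleton)
    thus ?thesis using False
      by (intro exI[of _ "sgn q2"] exI[of _ "k * norm q2"] exI[of _ "norm q2"]) (simp add: norm_sgn sgn_div_norm)
  qed
  then obtain w s t where w: "norm w = 1" "q1 = s *\<^sub>R w" "q2 = t *\<^sub>R w" by blast
  have "s \<noteq> t" using w assms by auto
  show thesis
  proof (cases "s < t")
    case True thus ?thesis using that[of w s t] w by simp
  next
    case False thus ?thesis using that[of "- w" "- s" "- t"] w \<open>s \<noteq> t\<close> by simp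
  qed
qed

lemma poincare_dist_dependent:
  fixes q1 q2 :: quat
  assumes n: "norm q1 < 1" "norm q2 < 1" and ne: "q1 \<noteq> q2" and dep: "dependent {q1, q2}"
  shows "poincare_dist q1 q2 = artanh (norm (disc_moebius q1 q2))"
proof -
  obtain u s t where u: "norm u = 1" and q: "q1 = s *\<^sub>R u" "q2 = t *\<^sub>R u" and "s < t"
    using dependent_pair_multiples[OF dep ne] by blast
  have st: "-1 < s" "t < 1" "s < 1" "-1 < t" using n u q \<open>s < t\<close> by auto
  define L where "L = closed_segment (- u) u"
  have inL: "x *\<^sub>R u \<in> L" if "-1 \<le> x" "x \<le> 1" for x
    using that by (auto simp: L_def closed_segment_antipodal)
  have "noneuclidean_line q1 q2 = (THE L. is_diameter L \<and> q1 \<in> L \<and> q2 \<in> L)"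
    using dep by (simp add: noneuclidean_line_def)
  also have "\<dots> = L"
  proof (rule the_equality)
    show "is_diameter L \<and> q1 \<in> L \<and> q2 \<in> L"
      using u st inL by (auto simp: is_diameter_def L_def q)
  next
    fix L' assume L': "is_diameter L' \<and> q1 \<in> L' \<and> q2 \<in> L'"
    then obtain w where w: "norm w = 1" "L' = closed_segment (- w) w" by (auto simp: is_diameter_def)
    obtain k where k: "k \<noteq> 0" "k *\<^sub>R u \<in> L'" using L' q ne by (cases "s = 0") auto
    then obtain x where x: "k *\<^sub>R u = x *\<^sub>R w" by (auto simp: w closed_segment_antipodal)
    have "norm (k *\<^sub>R u) = norm (x *\<^sub>R w)" by (simp only: x)
    hence "\<bar>k\<bar> = \<bar>x\<bar>" using u w by simp
    hence "x \<noteq> 0" and "x *\<^sub>R u = x *\<^sub>R w \<or> x *\<^sub>R (- u) = x *\<^sub>R w"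
      using x k by (auto simp: abs_eq_iff)
    hence "w = u \<or> w = - u" by (metis scaleR_cancel_left)
    thus "L' = L" by (auto simp: w L_def closed_segment_commute)
  qed
  finally have L: "noneuclidean_line q1 q2 = L" .
  have "L \<inter> sphere 0 1 = {1 *\<^sub>R u, (-1) *\<^sub>R u}"
  proof (intro equalityI subsetI)
    fix p assume p: "p \<in> L \<inter> sphere 0 1"
    then obtain x where x: "p = x *\<^sub>R u" by (auto simp: L_def closed_segment_antipodal)
    with p u have "x = 1 \<or> x = -1" by auto
    with x show "p \<in> {1 *\<^sub>R u, (-1) *\<^sub>R u}" by blast
  qed (use u inL[of 1] inL[of "-1"] in auto)
  hence ends: "line_ends q1 q2 = {1 *\<^sub>R u, (-1) *\<^sub>R u}" by (simp add: line_ends_def L)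
  have "cyclic_on_diameter L q1 q2 (1 *\<^sub>R u) ((-1) *\<^sub>R u)"
    unfolding cyclic_on_diameter_def
    by (rule exI[of _ u], rule exI[of _ s], rule exI[of _ t], rule exI[of _ 1], rule exI[of _ "-1"])
       (use u st \<open>s < t\<close> inL[of s] inL[of t] inL[of 1] inL[of "-1"] in \<open>auto simp: q L_def\<close>)
  hence arr: "arranged_cyclically (noneuclidean_line q1 q2) q1 q2 (1 *\<^sub>R u) ((-1) *\<^sub>R u)"
    by (simp add: arranged_cyclically_def L)
  define P where "P = (1 - s) * (1 + t)"
  define Q where "Q = (1 + s) * (1 - t)"
  have diff: "P - Q = 2 * (t - s)" and prod: "P * Q = (1 - s\<^sup>2) * (1 - t\<^sup>2)"
    by (simp_all add: P_def Q_def power2_eq_square algebra_simps)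
  have "0 < Q" using st by (simp add: Q_def)
  moreover have "Q < P" using diff \<open>s < t\<close> by simp
  ultimately have PQ: "0 < Q" "Q < P" .
  have "(1 - s) * (-1 - t) = - P" "(-1 - s) * (1 - t) = - Q"
    by (simp_all add: P_def Q_def algebra_simps)
  hence cr: "cross_ratio q1 q2 (1 *\<^sub>R u) ((-1) *\<^sub>R u) = of_real (P / Q)"
    unfolding q real_multiples_cross_ratio[OF u] by (simp only: minus_divide_divide)
  have "(norm (q2 - q1))\<^sup>2 = (t - s)\<^sup>2"
    using u by (simp add: q flip: scaleR_left_diff_distrib)
  moreover have "(norm q1)\<^sup>2 = s\<^sup>2" "(norm q2)\<^sup>2 = t\<^sup>2" using u by (simp_all add: q)
  ultimately have "(P - Q)\<^sup>2 * ((1 - (norm q1)\<^sup>2) * (1 - (norm q2)\<^sup>2)) = 4 * P * Q * (norm (q2 - q1))\<^sup>2"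
    by (simp only: diff prod[symmetric] power_mult_distrib) simp
  from half_ln_eq_artanh_disc_moebius[OF n PQ this]
  show ?thesis
    using poincare_dist_eqI[OF ne ends arr _ cr] PQ by simp
qed

section \<open>Uniqueness of the orthogonal circle\<close>

lemma in_span_pair: "q \<in> span {u, v} \<longleftrightarrow> (\<exists>x y. q = x *\<^sub>R u + y *\<^sub>R v)" for q :: quat
  by (auto simp: span_insert span_singleton algebra_simps diff_eq_eq)

lemma span_pair_unique:
  fixes a b u v :: quat
  assumes "independent {a, b}" "a \<noteq> b" "a \<in> span {u, v}" "b \<in> span {u, v}"
  shows "span {u, v} = span {a, b}"
proof (rule antisym)
  have "dim (span {u, v}) \<le> card {u, v}" by (simp add: dim_le_card')
  also have "\<dots> \<le> card {a, b}" using assms(2) by (simp add: card_insert_if)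
  finally show "span {u, v} \<subseteq> span {a, b}"
    using card_ge_dim_independent[of "{a, b}" "span {u, v}"] assms by simp
  show "span {a, b} \<subseteq> span {u, v}" using assms by (intro span_minimal) auto
qed

lemma circle_param_has_vector_derivative:
  "(circle_param c r u v has_vector_derivative r *\<^sub>R (- sin t *\<^sub>R u + cos t *\<^sub>R v)) (at t)"
proof -
  have "((\<lambda>t. c + r *\<^sub>R (cos t *\<^sub>R u + sin t *\<^sub>R v)) has_vector_derivative
      r *\<^sub>R (- sin t *\<^sub>R u + cos t *\<^sub>R v)) (at t)"
    by (auto intro!: derivative_eq_intros)
  thus ?thesis by (simp add: circle_param_def[abs_def])
qed

lemma vector_derivative_circle_param:
  "vector_derivative (circle_param c r u v) (at t) = r *\<^sub>R (- sin t *\<^sub>R u + cos t *\<^sub>R v)"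
  by (rule vector_derivative_at[OF circle_param_has_vector_derivative])

lemma range_circle_param_eq:
  assumes fr: "circle_frame r u v" and c: "c \<in> span {u, v}"
  shows "range (circle_param c r u v) = {q \<in> span {u, v}. norm (q - c) = r}"
proof (intro equalityI subsetI)
  fix q assume "q \<in> range (circle_param c r u v)"
  then obtain t where q: "q = c + r *\<^sub>R (cos t *\<^sub>R u + sin t *\<^sub>R v)"
    by (auto simp: circle_param_def)
  have "(norm (cos t *\<^sub>R u + sin t *\<^sub>R v))\<^sup>2 = 1"
    unfolding circle_frame_norm[OF fr] by (rule sin_cos_squared_add2)
  hence "norm (cos t *\<^sub>R u + sin t *\<^sub>R v) = 1" by (simp add: abs_square_eq_1)
  moreover have "cos t *\<^sub>R u + sin t *\<^sub>R v \<in> span {u, v}" using in_span_pair by blast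
  ultimately show "q \<in> {q \<in> span {u, v}. norm (q - c) = r}"
    using fr span_add[OF c span_scale, of _ r] by (simp add: q circle_frame_def)
next
  fix q assume q: "q \<in> {q \<in> span {u, v}. norm (q - c) = r}"
  have r: "r > 0" using fr by (simp add: circle_frame_def)
  have "q - c \<in> span {u, v}" using q c by (intro span_diff) auto
  then obtain x y where xy: "q - c = x *\<^sub>R u + y *\<^sub>R v" by (auto simp: in_span_pair)
  have "x\<^sup>2 + y\<^sup>2 = r\<^sup>2" using circle_frame_norm[OF fr, of x y] q by (simp add: xy)
  hence "(x / r)\<^sup>2 + (y / r)\<^sup>2 = 1" using r by (simp add: power_divide add_divide_distrib[symmetric])
  then obtain t where "x / r = cos t" "y / r = sin t" using sincos_total_2pi_le by blast
  hence "x = r * cos t" "y = r * sin t" using r by (auto simp: field_simps)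
  hence "q = circle_param c r u v t" using xy by (simp add: circle_param_def algebra_simps)
  thus "q \<in> range (circle_param c r u v)" by blast
qed

text \<open>Where the circle meets the sphere, its tangent is radial. Therefore the plane of the circle
  contains the origin, and the centre satisfies \<open>(norm c)\<^sup>2 = 1 + r\<^sup>2\<close>. With this the equation
  \<open>norm (q - c) = r\<close> becomes linear in \<open>c\<close>.\<close>

lemma orthogonal_circle_eq:
  assumes "is_orthogonal_circle L"
  obtains u v c where "c \<in> span {u, v}"
    "L = {q \<in> span {u, v}. (norm q)\<^sup>2 + 1 = 2 * inner c q}"
proof -
  from assms obtain c r u v where fr: "circle_frame r u v"
    and L: "L = range (circle_param c r u v)" and meets: "L \<inter> sphere 0 1 \<noteq> {}"
    and tangent: "\<forall>t. circle_param c r u v t \<in> sphere 0 1 \<longrightarrow> (\<forall>w. orthogonal w (circle_param c r u v t)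
        \<longrightarrow> orthogonal w (r *\<^sub>R (- sin t *\<^sub>R u + cos t *\<^sub>R v)))"
    unfolding is_orthogonal_circle_def vector_derivative_circle_param by blast
  from meets obtain t where p1: "norm (circle_param c r u v t) = 1" by (auto simp: L)
  have orth: "orthogonal w (r *\<^sub>R (- sin t *\<^sub>R u + cos t *\<^sub>R v))"
    if "orthogonal w (circle_param c r u v t)" for w
    using tangent that p1 by simp
  define p where "p = circle_param c r u v t"
  define D where "D = - sin t *\<^sub>R u + cos t *\<^sub>R v"
  define n where "n = cos t *\<^sub>R u + sin t *\<^sub>R v"
  have r: "r > 0" using fr by (simp add: circle_frame_def)
  have uv: "inner u u = 1" "inner v v = 1" "inner u v = 0" "inner v u = 0"
    using fr by (auto simp: circle_frame_def orthogonal_def norm_eq_1 inner_commute)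
  have D1: "inner D D = 1" and n1: "inner n n = 1" and Dn: "inner D n = 0"
    using sin_cos_squared_add[of t]
    by (simp_all add: D_def n_def inner_simps uv power2_eq_square add.commute)
  have pp: "inner p p = 1" using p1 by (simp add: p_def norm_eq_1)
  \<comment> \<open>The component of the tangent \<open>D\<close> along the sphere at \<open>p\<close> is orthogonal to \<open>p\<close>, hence to
    \<open>D\<close>, hence to itself; so \<open>D\<close> is a multiple of \<open>p\<close>.\<close>
  define k where "k = inner D p"
  have "inner (D - k *\<^sub>R p) p = 0" using pp by (simp add: inner_diff k_def)
  moreover from this have "inner (D - k *\<^sub>R p) D = 0"
    using orth[of "D - k *\<^sub>R p"] r by (simp add: orthogonal_def p_def D_def)
  ultimately have "inner (D - k *\<^sub>R p) (D - k *\<^sub>R p) = 0" by (simp add: inner_diff_right)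
  hence Dp: "D = k *\<^sub>R p" by simp
  hence k: "k \<noteq> 0" using D1 by auto
  have p: "p = inverse k *\<^sub>R D" using Dp k by simp
  have pc: "p = c + r *\<^sub>R n" by (simp add: p_def n_def circle_param_def)
  have "D \<in> span {u, v}" "n \<in> span {u, v}" unfolding D_def n_def in_span_pair by blast+
  hence "p - r *\<^sub>R n \<in> span {u, v}" unfolding p by (intro span_diff span_scale)
  hence c: "c \<in> span {u, v}" by (simp add: pc)
  have pn: "inner p n = 0" by (simp add: p Dn)
  have "c = p - r *\<^sub>R n" by (simp add: pc)
  hence cc: "inner c c = 1 + r\<^sup>2"
    using pn by (simp add: inner_diff pp n1 inner_commute power2_eq_square)
  have "norm (q - c) = r \<longleftrightarrow> (norm q)\<^sup>2 + 1 = 2 * inner c q" for q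
  proof -
    have "norm (q - c) = r \<longleftrightarrow> (norm (q - c))\<^sup>2 = r\<^sup>2" using r by (auto intro: power2_eq_imp_eq)
    also have "(norm (q - c))\<^sup>2 = (norm q)\<^sup>2 - 2 * inner c q + (1 + r\<^sup>2)"
      unfolding power2_norm_eq_inner by (simp add: inner_diff inner_commute cc)
    finally show ?thesis by auto
  qed
  hence "L = {q \<in> span {u, v}. (norm q)\<^sup>2 + 1 = 2 * inner c q}"
    unfolding L range_circle_param_eq[OF fr c] by simp
  with c show thesis by (rule that)
qed

text \<open>The plane is spanned by the two points, and the inner products of \<open>c\<close> with both of them are
  prescribed; a vector of the plane orthogonal to both vanishes.\<close>

lemma orthogonal_circle_unique:
  assumes ind: "independent {q1, q2}" "q1 \<noteq> q2"
    and "is_orthogonal_circle L" "q1 \<in> L" "q2 \<in> L"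
    and "is_orthogonal_circle L'" "q1 \<in> L'" "q2 \<in> L'"
  shows "L = L'"
proof -
  have *: "\<exists>c \<in> span {q1, q2}. M = {q \<in> span {q1, q2}. (norm q)\<^sup>2 + 1 = 2 * inner c q}"
    if "is_orthogonal_circle M" "q1 \<in> M" "q2 \<in> M" for M
  proof -
    obtain u v c where c: "c \<in> span {u, v}"
      and M: "M = {q \<in> span {u, v}. (norm q)\<^sup>2 + 1 = 2 * inner c q}"
      using orthogonal_circle_eq[OF \<open>is_orthogonal_circle M\<close>] by blast
    have "span {u, v} = span {q1, q2}"
      using span_pair_unique[OF ind, of u v] that by (simp add: M)
    thus ?thesis using c M by auto
  qed
  obtain c where c: "c \<in> span {q1, q2}" and L: "L = {q \<in> span {q1, q2}. (norm q)\<^sup>2 + 1 = 2 * inner c q}"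
    using * assms by blast
  obtain c' where c': "c' \<in> span {q1, q2}" and L': "L' = {q \<in> span {q1, q2}. (norm q)\<^sup>2 + 1 = 2 * inner c' q}"
    using * assms by blast
  have "inner c q1 = inner c' q1" "inner c q2 = inner c' q2"
    using assms by (auto simp: L L')
  hence 1: "inner (c - c') q1 = 0" "inner (c - c') q2 = 0" by (simp_all add: inner_diff)
  have "c - c' \<in> span {q1, q2}" using c c' by (rule span_diff)
  then obtain x y where "c - c' = x *\<^sub>R q1 + y *\<^sub>R q2" by (auto simp: in_span_pair)
  hence "inner (c - c') (c - c') = 0"
    using 1 by (metis inner_add_right inner_scaleR_right mult_zero_right add_0)
  thus ?thesis by (simp add: L L')
qed

section \<open>Existence of the orthogonal circle\<close>

text \<open>The circle with centre \<open>- (R *\<^sub>R u)\<close> and radius \<open>r\<close> crosses the unit sphere at the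
  parameters \<open>\<plusminus> arccos (r / R)\<close>: the triangle formed by the origin, the centre and a crossing
  point has a right angle at the crossing point.\<close>

lemma boundary_angle:
  fixes r R :: real
  assumes "r\<^sup>2 = R\<^sup>2 - 1" "0 < r" "0 < R"
  shows "cos (arccos (r / R)) = r / R" "0 < arccos (r / R)" "arccos (r / R) < pi / 2"
proof -
  have "r < R" by (rule power2_less_imp_less) (use assms in simp_all)
  hence *: "0 < r / R" "r / R < 1" using assms by simp_all
  thus "cos (arccos (r / R)) = r / R" by (intro cos_arccos) linarith+
  show "0 < arccos (r / R)" "arccos (r / R) < pi / 2"
    using arccos_less_arccos[of "r / R" 1] arccos_less_arccos[of 0 "r / R"] * by simp_all
qed

lemma geodesic_circle_norm:
  assumes fr: "circle_frame r u v" and r: "r\<^sup>2 = R\<^sup>2 - 1"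
  shows "1 - (norm (circle_param (- (R *\<^sub>R u)) r u v t))\<^sup>2 = 2 * r * (R * cos t - r)"
proof -
  have "circle_param (- (R *\<^sub>R u)) r u v t = (r * cos t - R) *\<^sub>R u + (r * sin t) *\<^sub>R v"
    by (simp add: circle_param_def algebra_simps)
  hence "(norm (circle_param (- (R *\<^sub>R u)) r u v t))\<^sup>2 = (r * cos t - R)\<^sup>2 + (r * sin t)\<^sup>2"
    by (simp only: circle_frame_norm[OF fr])
  also have "\<dots> = r\<^sup>2 * ((sin t)\<^sup>2 + (cos t)\<^sup>2) + R\<^sup>2 - 2 * r * R * cos t"
    by algebra
  also have "\<dots> = 1 - 2 * r * (R * cos t - r)"
    unfolding sin_cos_squared_add using r by (simp add: power2_eq_square algebra_simps)
  finally show ?thesis by simp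
qed

lemma geodesic_circle_orthogonal:
  assumes fr: "circle_frame r u v" and r: "r\<^sup>2 = R\<^sup>2 - 1" and R: "0 < R"
  shows "is_orthogonal_circle (range (circle_param (- (R *\<^sub>R u)) r u v))"
proof -
  let ?q = "circle_param (- (R *\<^sub>R u)) r u v"
  have r0: "r > 0" using fr by (simp add: circle_frame_def)
  have on: "norm (?q t) = 1 \<longleftrightarrow> r = R * cos t" for t
    using geodesic_circle_norm[OF fr r, of t] r0
    by (auto simp: abs_square_eq_1 power2_eq_1_iff)
  have meets: "norm (?q (arccos (r / R))) = 1"
    using R unfolding on boundary_angle(1)[OF r r0 R] by simp
  have tangent: "orthogonal w (vector_derivative ?q (at t))"
    if t: "norm (?q t) = 1" and w: "orthogonal w (?q t)" for t w
  proof -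
    have rt: "r = R * cos t" using t on by simp
    have "?q t = (r * cos t - R) *\<^sub>R u + (r * sin t) *\<^sub>R v"
      by (simp add: circle_param_def algebra_simps)
    also have "r * cos t - R = R * sin t * (- sin t)"
      using sin_cos_squared_add[of t] unfolding rt by (simp add: power2_eq_square) algebra
    also have "r * sin t = R * sin t * cos t" unfolding rt by simp
    finally have q: "?q t = (R * sin t) *\<^sub>R (- sin t *\<^sub>R u + cos t *\<^sub>R v)"
      by (simp add: algebra_simps)
    have "R * sin t \<noteq> 0" using t q by auto
    thus ?thesis using w unfolding q vector_derivative_circle_param
      by (simp add: orthogonal_def)
  qed
  have "?q (arccos (r / R)) \<in> range ?q \<inter> sphere 0 1" using meets by simp
  hence "range ?q \<inter> sphere 0 1 \<noteq> {}" by blast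
  thus ?thesis
    unfolding is_orthogonal_circle_def using fr tangent mem_sphere_0 by metis
qed

lemma geodesic_circle_sphere:
  assumes fr: "circle_frame r u v" and r: "r\<^sup>2 = R\<^sup>2 - 1" and R: "0 < R"
  defines "\<theta> \<equiv> arccos (r / R)" and "q \<equiv> circle_param (- (R *\<^sub>R u)) r u v"
  shows "range q \<inter> sphere 0 1 = {q \<theta>, q (2 * pi - \<theta>)}"
proof -
  have r0: "r > 0" using fr by (simp add: circle_frame_def)
  have \<theta>: "cos \<theta> = r / R" unfolding \<theta>_def by (rule boundary_angle(1)[OF r r0 R])
  have on: "norm (q t) = 1 \<longleftrightarrow> cos t = cos \<theta>" for t
    using geodesic_circle_norm[OF fr r, of t] r0 R
    by (auto simp: q_def \<theta> field_simps abs_square_eq_1 power2_eq_1_iff)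
  have "q t = q \<theta> \<or> q t = q (2 * pi - \<theta>)" if "cos t = cos \<theta>" for t
  proof -
    have "(sin t)\<^sup>2 = (sin \<theta>)\<^sup>2" using that by (simp add: sin_squared_eq)
    hence "sin t = sin \<theta> \<or> sin t = - sin \<theta>" by (simp add: power2_eq_iff)
    thus ?thesis using that by (auto simp: q_def circle_param_def)
  qed
  hence "p \<in> {q \<theta>, q (2 * pi - \<theta>)}" if "p \<in> range q \<inter> sphere 0 1" for p
    using that on by (metis IntE imageE insertCI mem_sphere_0)
  moreover have "cos (2 * pi - \<theta>) = cos \<theta>" by simp
  hence "{q \<theta>, q (2 * pi - \<theta>)} \<subseteq> range q \<inter> sphere 0 1" using on by simp
  ultimately show ?thesis by blast
qed

text \<open>A circle orthogonal to the sphere is \<open>{q. (norm q)\<^sup>2 + 1 = 2 * inner c q}\<close> within a plane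
  through the origin, so the centre is found by solving two linear equations. The resulting \<open>c\<close> lies
  outside the disc by the Cauchy-Schwarz inequality, as \<open>norm q < ((norm q)\<^sup>2 + 1) / 2\<close> for
  \<open>norm q < 1\<close>.\<close>

lemma exists_geodesic_circle:
  fixes q1 q2 :: quat
  assumes n: "norm q1 < 1" "norm q2 < 1" and ind: "independent {q1, q2}" and ne: "q1 \<noteq> q2"
  obtains r R u v t1 t2 where "circle_frame r u v" "r\<^sup>2 = R\<^sup>2 - 1" "1 < R" "t1 < t2"
    "\<bar>t1\<bar> < arccos (r / R)" "\<bar>t2\<bar> < arccos (r / R)"
    "q1 = circle_param (- (R *\<^sub>R u)) r u v t1" "q2 = circle_param (- (R *\<^sub>R u)) r u v t2"
proof -
  have nz: "q1 \<noteq> 0" "q2 \<noteq> 0" using ind dependent_zero[of "{q1, q2}"] by auto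
  have comb: "x = 0 \<and> y = 0" if "x *\<^sub>R q1 + y *\<^sub>R q2 = 0" for x y
  proof -
    have "x = 0"
    proof (rule ccontr)
      assume "x \<noteq> 0"
      have "x *\<^sub>R q1 = (- y) *\<^sub>R q2" using that by (simp add: add_eq_0_iff)
      hence "inverse x *\<^sub>R (x *\<^sub>R q1) = inverse x *\<^sub>R ((- y) *\<^sub>R q2)" by simp
      hence "q1 = (inverse x * - y) *\<^sub>R q2" using \<open>x \<noteq> 0\<close> by simp
      hence "q1 \<in> span {q2}" by (metis span_base span_scale singletonI)
      thus False using ind ne independent_insert[of q1 "{q2}"] by auto
    qed
    thus ?thesis using that nz by simp
  qed
  define k1 where "k1 = ((norm q1)\<^sup>2 + 1) / 2"
  define k2 where "k2 = ((norm q2)\<^sup>2 + 1) / 2"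
  have k: "k1 > 0" "k2 > 0" by (auto simp: k1_def k2_def intro!: add_nonneg_pos)
  \<comment> \<open>A vector of the plane orthogonal to any \<open>c\<close> with \<open>inner c q1 = k1\<close> and \<open>inner c q2 = k2\<close>.\<close>
  define w where "w = k2 *\<^sub>R q1 - k1 *\<^sub>R q2"
  have w0: "w \<noteq> 0" using comb[of k2 "- k1"] k by (auto simp: w_def)
  \<comment> \<open>The centre: by Cramer's rule for the Gram matrix of \<open>q1\<close> and \<open>q2\<close>, whose determinant is \<open>g\<close>.\<close>
  obtain c where c: "c \<in> span {q1, q2}" "inner c q1 = k1" "inner c q2 = k2"
  proof -
    define g where "g = inner q1 q1 * inner q2 q2 - (inner q1 q2)\<^sup>2"
    define a where "a = k1 * inner q2 q2 - k2 * inner q1 q2"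
    define b where "b = k2 * inner q1 q1 - k1 * inner q1 q2"
    have "inner q2 q2 *\<^sub>R q1 - inner q1 q2 *\<^sub>R q2 \<noteq> 0"
      using comb[of "inner q2 q2" "- inner q1 q2"] nz by auto
    hence "inner (inner q2 q2 *\<^sub>R q1 - inner q1 q2 *\<^sub>R q2) (inner q2 q2 *\<^sub>R q1 - inner q1 q2 *\<^sub>R q2) \<noteq> 0"
      by simp
    hence "inner q2 q2 * g \<noteq> 0"
      by (simp add: g_def inner_diff inner_commute[of q2 q1] power2_eq_square algebra_simps)
    hence g: "g \<noteq> 0" by auto
    have "inner (a *\<^sub>R q1 + b *\<^sub>R q2) q1 = k1 * g" "inner (a *\<^sub>R q1 + b *\<^sub>R q2) q2 = k2 * g"
      by (simp_all add: a_def b_def g_def inner_simps inner_commute[of q2 q1] power2_eq_square algebra_simps)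
    moreover have "inverse g *\<^sub>R (a *\<^sub>R q1 + b *\<^sub>R q2) \<in> span {q1, q2}"
      by (intro span_scale) (auto simp: in_span_pair)
    ultimately show thesis
      using that[of "inverse g *\<^sub>R (a *\<^sub>R q1 + b *\<^sub>R q2)"] g by simp
  qed
  define R where "R = norm c"
  have R: "R > 1"
  proof -
    have "norm q1 < k1"
    proof -
      have "0 < (1 - norm q1)\<^sup>2" using n by simp
      thus ?thesis by (simp add: k1_def power2_eq_square algebra_simps)
    qed
    also have "k1 \<le> R * norm q1" using norm_cauchy_schwarz[of c q1] by (simp add: c R_def)
    finally have "1 * norm q1 < R * norm q1" by simp
    thus ?thesis using nz by (subst (asm) mult_less_cancel_right_pos) auto
  qed
  define r where "r = sqrt (R\<^sup>2 - 1)"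
  have R2: "R\<^sup>2 > 1" using R by (simp add: one_less_power)
  hence r: "r\<^sup>2 = R\<^sup>2 - 1" "r > 0" by (simp_all add: r_def)
  have c0: "c \<noteq> 0" using R by (auto simp: R_def)
  define u where "u = - sgn c"
  define e where "e = sgn w"
  have wc: "inner w c = 0" by (simp add: w_def inner_diff c inner_commute[of _ c])
  have c_eq: "c = - (R *\<^sub>R u)" using c0 by (simp add: u_def R_def sgn_div_norm)
  have fr: "circle_frame r u e"
    using r c0 w0 wc by (simp add: circle_frame_def u_def e_def norm_sgn orthogonal_def sgn_div_norm inner_commute)
  have "e \<noteq> u" "e \<noteq> 0" "u \<noteq> 0"
    using fr by (auto simp: circle_frame_def orthogonal_def)
  have orth: "inner u u = 1" "inner e e = 1" "inner u e = 0" "inner e u = 0"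
    using fr by (auto simp: circle_frame_def orthogonal_def norm_eq_1 inner_commute)
  have ue: "u \<in> span {q1, q2}" "e \<in> span {q1, q2}"
  proof -
    show "u \<in> span {q1, q2}" using c(1) unfolding u_def sgn_div_norm by (intro span_neg span_scale)
    have "w \<in> span {q1, q2}" unfolding w_def by (intro span_diff span_scale span_base) auto
    thus "e \<in> span {q1, q2}" unfolding e_def sgn_div_norm by (intro span_scale)
  qed
  have "independent {u, e}"
    using \<open>e \<noteq> 0\<close> \<open>u \<noteq> 0\<close> orth
    by (intro pairwise_orthogonal_independent) (auto simp: pairwise_def orthogonal_def)
  hence span: "span {q1, q2} = span {u, e}"
    using \<open>e \<noteq> u\<close> ue by (intro span_pair_unique) auto
  define \<theta> where "\<theta> = arccos (r / R)"
  have \<theta>: "cos \<theta> = r / R" "0 \<le> \<theta>" "\<theta> \<le> pi"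
    using boundary_angle[OF r] R by (simp_all add: \<theta>_def)
  have param: "\<exists>t. \<bar>t\<bar> < \<theta> \<and> q = circle_param (- (R *\<^sub>R u)) r u e t"
    if q: "q \<in> span {q1, q2}" "norm q < 1" "inner c q = ((norm q)\<^sup>2 + 1) / 2" for q
  proof -
    obtain x y where xy: "q = x *\<^sub>R u + y *\<^sub>R e" using q(1) unfolding span in_span_pair by blast
    have nq: "(norm q)\<^sup>2 = x\<^sup>2 + y\<^sup>2" unfolding xy by (rule circle_frame_norm[OF fr])
    have iq: "inner c q = - (R * x)" by (simp add: c_eq xy inner_simps orth)
    have "- (R * x) < 1" using q iq norm_square_less_one[of q] by simp
    \<comment> \<open>So \<open>q\<close> lies on the half of the circle facing the origin, and \<open>arcsin\<close> returns its parameter.\<close>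
    hence "0 < (x + R) * R" using R2 by (simp add: power2_eq_square algebra_simps)
    hence x: "x + R > 0" using R by (simp add: zero_less_mult_iff)
    have eq: "(x + R)\<^sup>2 + y\<^sup>2 = r\<^sup>2"
      using q(3) nq iq r by (simp add: power2_eq_square algebra_simps)
    define t where "t = arcsin (y / r)"
    have "y\<^sup>2 \<le> r\<^sup>2" using eq by (metis zero_le_power2 le_add_same_cancel2)
    hence "\<bar>y\<bar> \<le> \<bar>r\<bar>" using abs_le_square_iff by blast
    hence "\<bar>y / r\<bar> \<le> 1" using r(2) by simp
    hence "-1 \<le> y / r" "y / r \<le> 1" by linarith+
    hence t: "sin t = y / r" "- (pi / 2) \<le> t" "t \<le> pi / 2"
      unfolding t_def by (rule sin_arcsin arcsin_lbound arcsin_ubound)+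
    have "((x + R) / r)\<^sup>2 = (r\<^sup>2 - y\<^sup>2) / r\<^sup>2" using eq by (simp add: power_divide)
    also have "\<dots> = (cos t)\<^sup>2"
      unfolding cos_squared_eq t using r(2) by (simp add: power_divide diff_divide_distrib)
    finally have "(cos t)\<^sup>2 = ((x + R) / r)\<^sup>2" ..
    moreover have "0 \<le> cos t" "0 \<le> (x + R) / r" using cos_ge_zero[of t] t x r(2) by simp_all
    ultimately have ct: "cos t = (x + R) / r" by (rule power2_eq_imp_eq)
    have "q = circle_param (- (R *\<^sub>R u)) r u e t"
      using r by (simp add: circle_param_def t ct xy scaleR_add_right scaleR_add_left)
    moreover have "\<bar>t\<bar> < \<theta>"
    proof -
      have "0 < 1 - (norm q)\<^sup>2" using norm_square_less_one[OF q(2)] by simp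
      also have "\<dots> = 2 * r * (R * cos t - r)"
        unfolding \<open>q = circle_param (- (R *\<^sub>R u)) r u e t\<close> by (rule geodesic_circle_norm[OF fr r(1)])
      finally have "cos \<theta> < cos \<bar>t\<bar>"
        unfolding \<theta>(1) using r R by (simp add: zero_less_mult_iff field_simps)
      thus ?thesis using cos_mono_less_eq[of \<theta> "\<bar>t\<bar>"] \<theta> t by (simp add: abs_le_iff)
    qed
    ultimately show ?thesis by blast
  qed
  obtain t1 where t1: "\<bar>t1\<bar> < \<theta>" "q1 = circle_param (- (R *\<^sub>R u)) r u e t1"
    using param[of q1] n c by (auto simp: k1_def span_base)
  obtain t2 where t2: "\<bar>t2\<bar> < \<theta>" "q2 = circle_param (- (R *\<^sub>R u)) r u e t2"
    using param[of q2] n c by (auto simp: k2_def span_base)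
  have "t1 \<noteq> t2" using t1 t2 ne by auto
  \<comment> \<open>Reversing \<open>e\<close> reverses the orientation, which puts the two parameters in increasing order.\<close>
  have flip: "circle_param (- (R *\<^sub>R u)) r u e t = circle_param (- (R *\<^sub>R u)) r u (- e) (- t)" for t
    by (simp add: circle_param_def)
  have fr': "circle_frame r u (- e)" using fr by (simp add: circle_frame_def orthogonal_def)
  show thesis
  proof (cases "t1 < t2")
    case True
    thus ?thesis using that[OF fr r(1) R, of t1 t2] t1 t2 by (simp add: \<theta>_def)
  next
    case False
    thus ?thesis using that[OF fr' r(1) R, of "- t1" "- t2"] t1 t2 \<open>t1 \<noteq> t2\<close>
      by (simp add: \<theta>_def flip)
  qed
qed

section \<open>The Poincare distance\<close>

text \<open>The circle meets the sphere at the parameters \<open>\<theta> = arccos (r / R)\<close> and \<open>2 * pi - \<theta>\<close>. All quantities in the criterion for the value of the distance are products of sines: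
  \<open>1 - (norm q)\<^sup>2\<close> becomes the product of the distances to the two ends, up to a constant, and
  \<open>P - Q\<close> is given by Ptolemy's theorem.\<close>

lemma poincare_dist_independent:
  fixes q1 q2 :: quat
  assumes n: "norm q1 < 1" "norm q2 < 1" and ne: "q1 \<noteq> q2" and ind: "independent {q1, q2}"
  shows "poincare_dist q1 q2 = artanh (norm (disc_moebius q1 q2))"
proof -
  obtain r R u v t1 t2 where fr: "circle_frame r u v" and r: "r\<^sup>2 = R\<^sup>2 - 1" and R: "1 < R"
    and "t1 < t2" and t0: "\<bar>t1\<bar> < arccos (r / R)" "\<bar>t2\<bar> < arccos (r / R)"
    and q': "q1 = circle_param (- (R *\<^sub>R u)) r u v t1" "q2 = circle_param (- (R *\<^sub>R u)) r u v t2"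
    using exists_geodesic_circle[OF n ind ne] by metis
  define \<theta> where "\<theta> = arccos (r / R)"
  define q where "q = circle_param (- (R *\<^sub>R u)) r u v"
  have r0: "r > 0" using fr by (simp add: circle_frame_def)
  have t: "- \<theta> < t1" "t1 < t2" "t2 < \<theta>" using t0 \<open>t1 < t2\<close> by (auto simp: \<theta>_def)
  have \<theta>: "cos \<theta> = r / R" "\<theta> < pi / 2"
    using boundary_angle[OF r r0] R by (simp_all add: \<theta>_def)
  have qi: "q1 = q t1" "q2 = q t2" using q' by (simp_all add: q_def)
  define L where "L = range q"
  have orthL: "is_orthogonal_circle L"
    unfolding L_def q_def by (rule geodesic_circle_orthogonal[OF fr r]) (use R in simp)
  have "noneuclidean_line q1 q2 = (THE L. is_orthogonal_circle L \<and> q1 \<in> L \<and> q2 \<in> L)"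
    using ind by (simp add: noneuclidean_line_def)
  also have "\<dots> = L"
  proof (rule the_equality)
    show L: "is_orthogonal_circle L \<and> q1 \<in> L \<and> q2 \<in> L" using orthL by (auto simp: L_def qi)
    show "L' = L" if "is_orthogonal_circle L' \<and> q1 \<in> L' \<and> q2 \<in> L'" for L'
      using orthogonal_circle_unique[OF ind ne, of L' L] that L by blast
  qed
  finally have L: "noneuclidean_line q1 q2 = L" .
  have ends: "line_ends q1 q2 = {q \<theta>, q (2 * pi - \<theta>)}"
    unfolding line_ends_def L L_def \<theta>_def q_def
    by (rule geodesic_circle_sphere[OF fr r]) (use R in simp)
  have "cyclic_on_circle L q1 q2 (q \<theta>) (q (2 * pi - \<theta>))"
    unfolding cyclic_on_circle_def
    by (rule exI[of _ "- (R *\<^sub>R u)"], rule exI[of _ r], rule exI[of _ u], rule exI[of _ v],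
        rule exI[of _ t1], rule exI[of _ t2], rule exI[of _ \<theta>], rule exI[of _ "2 * pi - \<theta>"])
       (use fr t \<theta> in \<open>auto simp: L_def q_def[symmetric] qi\<close>)
  hence arr: "arranged_cyclically (noneuclidean_line q1 q2) q1 q2 (q \<theta>) (q (2 * pi - \<theta>))"
    by (simp add: arranged_cyclically_def L)
  define P where "P = sin ((\<theta> - t1) / 2) * sin ((\<theta> + t2) / 2)"
  define Q where "Q = sin ((\<theta> + t1) / 2) * sin ((\<theta> - t2) / 2)"
  have s: "sin ((2 * pi - \<theta> - x) / 2) = sin ((\<theta> + x) / 2)" for x
    using sin_pi_minus[of "(\<theta> + x) / 2"] by (simp add: diff_divide_distrib add_divide_distrib algebra_simps)
  have pos: "sin ((\<theta> - t1) / 2) > 0" "sin ((\<theta> + t2) / 2) > 0" "sin ((\<theta> + t1) / 2) > 0"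
     "sin ((\<theta> - t2) / 2) > 0" "sin ((t2 - t1) / 2) > 0"
    by (rule sin_gt_zero; use t \<theta> in simp)+
  have Q: "Q > 0" using pos by (simp add: Q_def)
  have cr: "cross_ratio q1 q2 (q \<theta>) (q (2 * pi - \<theta>)) = of_real (P / Q)"
    unfolding qi q_def circle_cross_ratio[OF fr] s P_def Q_def ..
  have sin\<theta>: "sin \<theta> = 1 / R"
  proof (rule power2_eq_imp_eq)
    show "(sin \<theta>)\<^sup>2 = (1 / R)\<^sup>2"
      unfolding sin_squared_eq \<theta>(1) using R r by (simp add: power_divide field_simps)
    show "0 \<le> sin \<theta>" using t \<theta> by (intro sin_ge_zero) auto
  qed (use R in simp)
  have PQ: "P - Q = sin ((t2 - t1) / 2) * sin \<theta>"
  proof -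
    have *: "(2 * pi - \<theta> - \<theta>) / 2 = pi - \<theta>" by simp
    have "P = Q + sin ((t2 - t1) / 2) * sin \<theta>"
      using ptolemy_sin[of \<theta> t1 "2 * pi - \<theta>" t2] unfolding s * P_def Q_def by simp
    thus ?thesis by simp
  qed
  have "0 < P - Q" unfolding PQ sin\<theta> using pos R by simp
  hence "Q < P" by simp
  have "norm (q2 - q1) = 2 * r * sin ((t2 - t1) / 2)"
    unfolding qi q_def circle_chord using pos r0 norm_chord_direction[OF fr] by simp
  hence M: "(norm (q2 - q1))\<^sup>2 = 4 * r\<^sup>2 * (sin ((t2 - t1) / 2))\<^sup>2"
    by (simp add: power_mult_distrib)
  have N: "1 - (norm (q x))\<^sup>2 = 4 * r * R * (sin ((\<theta> + x) / 2) * sin ((\<theta> - x) / 2))" for x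
  proof -
    have "cos x - cos \<theta> = 2 * sin ((\<theta> + x) / 2) * sin ((\<theta> - x) / 2)"
      by (simp add: cos_diff_cos add.commute)
    moreover have "1 - (norm (q x))\<^sup>2 = 2 * r * R * (cos x - cos \<theta>)"
      unfolding q_def geodesic_circle_norm[OF fr r] \<theta> using R by (simp add: field_simps)
    ultimately show ?thesis by simp
  qed
  have "(1 - (norm q1)\<^sup>2) * (1 - (norm q2)\<^sup>2) = 16 * r\<^sup>2 * R\<^sup>2 * (P * Q)"
    unfolding qi N P_def Q_def by (simp add: power2_eq_square)
  hence "(P - Q)\<^sup>2 * ((1 - (norm q1)\<^sup>2) * (1 - (norm q2)\<^sup>2)) = 4 * P * Q * (norm (q2 - q1))\<^sup>2"
    unfolding PQ M sin\<theta> using R by (simp add: power_mult_distrib power_divide)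
  from half_ln_eq_artanh_disc_moebius[OF n Q \<open>Q < P\<close> this]
  show ?thesis
    using poincare_dist_eqI[OF ne ends arr _ cr] Q \<open>Q < P\<close> by simp
qed

lemma poincare_dist_eq_artanh:
  assumes "norm q1 < 1" "norm q2 < 1"
  shows "poincare_dist q1 q2 = artanh (norm (disc_moebius q1 q2))"
proof (cases "q1 = q2")
  case True
  thus ?thesis by (simp add: poincare_dist_def disc_moebius_def)
next
  case False
  thus ?thesis using poincare_dist_dependent poincare_dist_independent assms by blast
qed

theorem proposition1p10:
  fixes q1 q2 :: quat
  assumes "q1 \<in> unit_disc" and "q2 \<in> unit_disc"
  shows "ereal (poincare_dist q1 q2) = enn2ereal (integrated_dist q1 q2)"
proof -
  have n: "norm q1 < 1" "norm q2 < 1" using assms by simp_all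
  have "0 \<le> artanh (norm (disc_moebius q1 q2))"
    using norm_disc_moebius_less_one[OF n] by (simp add: artanh_def ln_ge_zero field_simps)
  thus ?thesis
    unfolding poincare_dist_eq_artanh[OF n] integrated_dist_eq_artanh[OF n] by simp
qed

end
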